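(* Let $m, M \geq 1$ and suppose $f: \mathbb{B}^m \rightarrow \mathbb{B}^M$ is a proper holomorphic map which extends to a $\mathcal{C}^2$-smooth map $\overline{\mathbb{B}^m} \rightarrow \overline{\mathbb{B}^M}$. If the group $$ \mathsf{G}_f := \left\{ (\phi, \psi) : \phi \in \mathrm{Aut}(\mathbb{B}^m),\ \psi \in \mathrm{Aut}(\mathbb{B}^M),\ \psi \circ f = f \circ \phi\right\} $$ is non-compact, then there exist $\varphi_1 \in \mathrm{Aut}(\mathbb{B}^m)$ and $\varphi_2 \in \mathrm{Aut}(\mathbb{B}^M)$ such that $$ \varphi_2 \circ f \circ \varphi_1(z) = (z,0) $$ for all $z \in \mathbb{B}^m$.
   Context: $\mathbb{B}^k \subset \mathbb{C}^k$ denotes the open Euclidean unit ball and $\overline{\mathbb{B}^k}$ its closure. For a bounded open set $V \subset \mathbb{C}^k$, $\mathrm{Aut}(V)$ is the group of biholomorphic maps $V \to V$; by a theorem of Cartan it is a Lie group for which the action map $(\varphi,z) \in \mathrm{Aut}(V)\times V \mapsto \varphi(z)\in V$ is smooth (its topology is that of uniform convergence on compact sets). The group $\mathsf{G}_f$ is given the subspace topology from $\mathrm{Aut}(\mathbb{B}^m) \times \mathrm{Aut}(\mathbb{B}^M)$. A map is proper if preimages of compact sets are compact. In $(z,0)$, the $0$ is the zero vector of $\mathbb{C}^{M-m}$ (the existence of a proper holomorphic map $\mathbb{B}^m\to\mathbb{B}^M$ forces $m \leq M$). *)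

theory Defs
  imports "HOL-Analysis.Analysis"
begin

text \<open>The space \<open>complex ^ 'm\<close> carries the Euclidean norm, so \<open>ball 0 1\<close> and \<open>cball 0 1\<close> are the
  open and closed Euclidean unit balls. As \<open>has_derivative\<close> is real Frechet differentiability,
  complex linearity of the derivative is required separately.\<close>

definition holomorphic_map_on :: "(complex ^ 'm \<Rightarrow> complex ^ 'n) \<Rightarrow> (complex ^ 'm) set \<Rightarrow> bool"
  where "holomorphic_map_on f U \<longleftrightarrow>
    (\<forall>z\<in>U. \<exists>D. (f has_derivative D) (at z) \<and> (\<forall>c v. D (c *s v) = c *s D v))"

definition proper_between ::
    "'a::topological_space set \<Rightarrow> 'b::topological_space set \<Rightarrow> ('a \<Rightarrow> 'b) \<Rightarrow> bool"
  where "proper_between U V f \<longleftrightarrow>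
    f \<in> U \<rightarrow> V \<and> (\<forall>K. K \<subseteq> V \<longrightarrow> compact K \<longrightarrow> compact {x\<in>U. f x \<in> K})"

definition C2_on_open :: "('a::real_normed_vector \<Rightarrow> 'b::real_normed_vector) \<Rightarrow> 'a set \<Rightarrow> bool"
  where "C2_on_open g U \<longleftrightarrow>
    (\<exists>(g' :: 'a \<Rightarrow> 'a \<Rightarrow>\<^sub>L 'b) (g'' :: 'a \<Rightarrow> 'a \<Rightarrow>\<^sub>L ('a \<Rightarrow>\<^sub>L 'b)).
      (\<forall>x\<in>U. (g has_derivative blinfun_apply (g' x)) (at x)) \<and>
      (\<forall>x\<in>U. (g' has_derivative blinfun_apply (g'' x)) (at x)) \<and>
      continuous_on U g'')"

text \<open>Smoothness on a set that need not be open (here a closed ball) has its usual meaning for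
  manifolds with boundary: near every point the map is the restriction of a \<open>C\<^sup>2\<close> map defined on an
  open set.\<close>

definition C2_smooth_on :: "('a::real_normed_vector \<Rightarrow> 'b::real_normed_vector) \<Rightarrow> 'a set \<Rightarrow> bool"
  where "C2_smooth_on F S \<longleftrightarrow>
    (\<forall>x\<in>S. \<exists>U g. open U \<and> x \<in> U \<and> C2_on_open g U \<and> (\<forall>y\<in>U \<inter> S. g y = F y))"

text \<open>Elements of \<open>Aut V\<close> are maps on \<open>V\<close> only; they are represented by their extensional
  extensions, so that equality in \<open>Aut V\<close> is equality on \<open>V\<close>.\<close>

definition Aut :: "(complex ^ 'm) set \<Rightarrow> (complex ^ 'm \<Rightarrow> complex ^ 'm) set"
  where "Aut V = {\<phi> \<in> extensional V. bij_betw \<phi> V V \<and>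
    holomorphic_map_on \<phi> V \<and> holomorphic_map_on (inv_into V \<phi>) V}"

text \<open>The topology of uniform convergence on compact subsets of \<open>V\<close>.\<close>

definition Aut_topology :: "(complex ^ 'm) set \<Rightarrow> (complex ^ 'm \<Rightarrow> complex ^ 'm) topology"
  where "Aut_topology V = topology_generated_by
    {{\<psi> \<in> Aut V. \<forall>z\<in>K. dist (\<psi> z) (\<phi> z) < e} | \<phi> K e.
      \<phi> \<in> Aut V \<and> compact K \<and> K \<subseteq> V \<and> 0 < e}"

lemma topspace_Aut_topology: "topspace (Aut_topology V) = Aut V"
proof -
  have "Aut V \<subseteq> topspace (Aut_topology V)"
  proof
    fix \<phi> assume "\<phi> \<in> Aut V"
    moreover have "openin (Aut_topology V) {\<psi> \<in> Aut V. \<forall>z\<in>{}. dist (\<psi> z) (\<phi> z) < 1}"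
      unfolding Aut_topology_def using \<open>\<phi> \<in> Aut V\<close>
      by (intro topology_generated_by_Basis CollectI exI[of _ \<phi>] exI[of _ "{}"] exI[of _ 1]) auto
    ultimately show "\<phi> \<in> topspace (Aut_topology V)"
      using openin_subset by fastforce
  qed
  then show ?thesis
    unfolding Aut_topology_def topology_generated_by_topspace by auto
qed

definition G_group :: "(complex ^ 'm \<Rightarrow> complex ^ 'n) \<Rightarrow>
    ((complex ^ 'm \<Rightarrow> complex ^ 'm) \<times> (complex ^ 'n \<Rightarrow> complex ^ 'n)) set"
  where "G_group f = {(\<phi>, \<psi>). \<phi> \<in> Aut (ball 0 1) \<and> \<psi> \<in> Aut (ball 0 1) \<and>
    (\<forall>z\<in>ball 0 1. \<psi> (f z) = f (\<phi> z))}"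

definition G_topology :: "(complex ^ 'm \<Rightarrow> complex ^ 'n) \<Rightarrow>
    ((complex ^ 'm \<Rightarrow> complex ^ 'm) \<times> (complex ^ 'n \<Rightarrow> complex ^ 'n)) topology"
  where "G_topology f =
    subtopology (prod_topology (Aut_topology (ball 0 1)) (Aut_topology (ball 0 1))) (G_group f)"

text \<open>The vector \<open>(z, 0)\<close>. The coordinates of \<open>complex ^ 'n\<close> are indexed by an unordered finite type,
  so an injection \<open>\<iota>\<close> says which of them are the first \<open>CARD('m)\<close> coordinates and in which order.\<close>

definition pad_zero :: "('m \<Rightarrow> 'n) \<Rightarrow> complex ^ 'm \<Rightarrow> complex ^ 'n"
  where "pad_zero \<iota> z = (\<chi> j. if j \<in> range \<iota> then z $ inv \<iota> j else 0)"

end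

theory Submission
  imports Defs "HOL-Complex_Analysis.Conformal_Mappings"
begin

text \<open>The strategy is to show that \<open>f\<close> is an isometry for the Bergman metrics at one point, say at \<open>0\<close>.
  Let \<open>B\<^sub>z(v)\<close> be the squared Bergman length of \<open>v\<close> at \<open>z\<close>. Once \<open>B\<^bsub>f 0\<^esub>(Df\<^sub>0 v) = B\<^sub>0(v) = \<bar>v\<bar>\<^sup>2\<close>
  for all \<open>v\<close>, an automorphism of the target moves \<open>f 0\<close> to \<open>0\<close>, the derivative at \<open>0\<close> of the new map
  preserves norms, and the equality case of the Schwarz lemma shows that the new map is the
  restriction of a linear isometry (\<open>linear_normal_form\<close>). A unitary map of the target then turns it
  into \<open>z \<mapsto> (z, 0)\<close> (\<open>unitary_completion\<close>).

  The equality comes from the boundary. If the group is not compact, it contains \<open>(\<phi>\<^sub>n, \<psi>\<^sub>n)\<close> such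
  that \<open>w\<^sub>n = \<phi>\<^sub>n 0\<close> tends to a point \<open>p\<close> of the sphere (\<open>compact_G_topology\<close>). Automorphisms preserve
  the Bergman metric, by the infinitesimal Schwarz-Pick inequality for the map and its inverse. Let
  \<open>v\<^sub>n\<close> be the image of \<open>v\<close> under the derivative of \<open>\<phi>\<^sub>n\<close> at \<open>0\<close>. Then \<open>\<psi>\<^sub>n \<circ> f = f \<circ> \<phi>\<^sub>n\<close> shows that, for
  every \<open>n\<close>, \<open>B\<^bsub>f 0\<^esub>(Df\<^sub>0 v)\<close> is the squared length of \<open>Df v\<^sub>n\<close> at \<open>f w\<^sub>n\<close>, while \<open>\<bar>v\<bar>\<^sup>2\<close> is that of \<open>v\<^sub>n\<close>
  at \<open>w\<^sub>n\<close>. It remains to see that \<open>f\<close> is asymptotically isometric at the boundary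
  (\<open>bergman_asymptotically_isometric\<close>).

  For this, note that \<open>\<bar>f\<bar>\<^sup>2 = 1\<close> on the sphere because \<open>f\<close> is proper. Let \<open>\<lambda>\<close> be the normal
  derivative of \<open>\<bar>f\<bar>\<^sup>2 / 2\<close> at \<open>p\<close>; it is positive by Schwarz-Pick (\<open>Hopf_ball\<close>). Differentiating
  \<open>\<bar>f\<bar>\<^sup>2 = 1\<close> once along the sphere shows that \<open>\<langle>Df\<^sub>p v, f p\<rangle> = \<lambda> \<langle>v, p\<rangle>\<close>. Differentiating it twice in
  complex tangent directions \<open>u\<close> and \<open>\<i> u\<close> and adding removes the second derivative of \<open>f\<close>, which is
  complex bilinear, and leaves \<open>\<bar>Df\<^sub>p u\<bar>\<^sup>2 = \<lambda> \<bar>u\<bar>\<^sup>2\<close> (\<open>norm_boundary_derivative\<close>). Also \<open>1 - \<bar>f w\<bar>\<^sup>2\<close> is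
  asymptotic to \<open>\<lambda> (1 - \<bar>w\<bar>\<^sup>2)\<close>. In the Bergman metric
  \<open>\<bar>v\<bar>\<^sup>2 / (1 - \<bar>w\<bar>\<^sup>2) + \<bar>\<langle>v, w\<rangle>\<bar>\<^sup>2 / (1 - \<bar>w\<bar>\<^sup>2)\<^sup>2\<close> all factors \<open>\<lambda>\<close> cancel in the limit.\<close>

section \<open>The Hermitian product and the involutions of the ball\<close>

text \<open>Linear in the first argument; its real part is the real inner product.\<close>

definition herm :: "complex ^ 'n \<Rightarrow> complex ^ 'n \<Rightarrow> complex"
  where "herm x y = (\<Sum>i\<in>UNIV. x $ i * cnj (y $ i))"

lemma herm_add_left: "herm (x + y) z = herm x z + herm y z"
  and herm_diff_left: "herm (x - y) z = herm x z - herm y z"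
  and herm_scale_left: "herm (c *s x) z = c * herm x z"
  and herm_add_right: "herm z (x + y) = herm z x + herm z y"
  and herm_diff_right: "herm z (x - y) = herm z x - herm z y"
  and herm_scale_right: "herm z (c *s x) = cnj c * herm z x"
  and herm_zero_left [simp]: "herm 0 x = 0"
  and herm_zero_right [simp]: "herm x 0 = 0"
  by (simp_all add: herm_def sum.distrib sum_subtractf sum_distrib_left algebra_simps)

lemmas herm_simps = herm_add_left herm_diff_left herm_scale_left
  herm_add_right herm_diff_right herm_scale_right

lemma scaleR_eq_scale: "r *\<^sub>R (x :: complex ^ 'n) = of_real r *s x"
  by (simp add: vec_eq_iff scaleR_conv_of_real[where 'a=complex])

lemma herm_scaleR_left: "herm (r *\<^sub>R x) y = r *\<^sub>R herm x y"
  and herm_scaleR_right: "herm x (r *\<^sub>R y) = r *\<^sub>R herm x y"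
  unfolding scaleR_eq_scale by (simp_all add: herm_simps scaleR_conv_of_real[where 'a=complex])

lemma cnj_herm: "cnj (herm x y) = herm y x"
  by (simp add: herm_def mult.commute)

lemma Re_herm: "Re (herm x y) = x \<bullet> y"
  by (simp add: herm_def inner_vec_def inner_complex_def)

text \<open>The real inner product determines the Hermitian one. Statements about real derivatives are
  turned into complex ones by this formula.\<close>

lemma herm_eq_inner: "herm x y = Complex (x \<bullet> y) (- ((\<i> *s x) \<bullet> y))"
  unfolding Re_herm[symmetric] by (simp add: herm_simps complex_eq_iff)

lemma herm_self: "herm x x = of_real ((norm x)\<^sup>2)"
proof -
  have "Im (herm x x) = 0"
    using arg_cong[OF cnj_herm[of x x], of Im] by simp
  then show ?thesis
    by (simp add: complex_eq_iff Re_herm power2_norm_eq_inner)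
qed

lemma norm_scale: "norm (c *s x) = cmod c * norm (x :: complex ^ 'n)"
proof -
  have "complex_of_real ((norm (c *s x))\<^sup>2) = (c * cnj c) * herm x x"
    unfolding herm_self[symmetric] by (simp add: herm_simps)
  also have "\<dots> = of_real ((cmod c * norm x)\<^sup>2)"
    unfolding complex_norm_square[symmetric] herm_self by (simp add: power_mult_distrib)
  finally have "complex_of_real ((norm (c *s x))\<^sup>2) = of_real ((cmod c * norm x)\<^sup>2)" .
  then have "(norm (c *s x))\<^sup>2 = (cmod c * norm x)\<^sup>2"
    using of_real_eq_iff by blast
  then show ?thesis by simp
qed

text \<open>Turning \<open>x\<close> by a unimodular factor makes the Hermitian product real, so that it becomes
  a real inner product.\<close>

lemma Cauchy_Schwarz_herm: "cmod (herm x y) \<le> norm x * norm y"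
proof (cases "herm x y = 0")
  case False
  define u where "u = cnj (herm x y) / cmod (herm x y)"
  have "u * herm x y = cmod (herm x y)"
    using False complex_norm_square[of "herm x y"]
    by (simp add: u_def power2_eq_square mult.commute divide_simps)
  moreover have "cmod u = 1"
    using False by (simp add: u_def norm_divide)
  ultimately have "cmod (herm x y) = Re (herm (u *s x) y)" "norm (u *s x) = norm x"
    by (simp_all add: herm_simps norm_scale)
  then show ?thesis
    by (metis Re_herm norm_cauchy_schwarz)
qed simp

text \<open>The equality case of Cauchy-Schwarz: under these assumptions
  \<open>\<bar>x - y\<bar>\<^sup>2 = \<bar>x\<bar>\<^sup>2 - \<bar>y\<bar>\<^sup>2\<close>.\<close>

lemma herm_equality_imp_eq:
  assumes "herm x y = (norm y)\<^sup>2" and "norm x \<le> norm y"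
  shows "x = y"
proof -
  have "x \<bullet> y = (norm y)\<^sup>2"
    unfolding Re_herm[symmetric] assms(1) by simp
  then have "(norm (x - y))\<^sup>2 = (norm x)\<^sup>2 - (norm y)\<^sup>2"
    by (simp add: power2_norm_eq_inner inner_diff inner_commute)
  also have "\<dots> \<le> 0"
    using assms(2) by (simp add: power_mono)
  finally show ?thesis by simp
qed

lemma bounded_linear_herm_left: "bounded_linear (\<lambda>x. herm x y)"
  by (rule bounded_linear_intro[where K="norm y"])
     (simp_all add: herm_simps herm_scaleR_left Cauchy_Schwarz_herm)

lemma bounded_bilinear_herm: "bounded_bilinear herm"
  by (rule bounded_bilinear.intro)
     (auto simp: herm_simps herm_scaleR_left herm_scaleR_right Cauchy_Schwarz_herm
       intro: exI[of _ 1])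

lemma bounded_bilinear_scale: "bounded_bilinear (\<lambda>c (x :: complex ^ 'n). c *s x)"
  by (rule bounded_bilinear.intro)
     (auto simp: vec_eq_iff algebra_simps norm_scale intro: exI[of _ 1])

lemmas tendsto_herm [tendsto_intros] = bounded_bilinear.tendsto[OF bounded_bilinear_herm]
lemmas continuous_on_herm [continuous_intros] =
  bounded_bilinear.continuous_on[OF bounded_bilinear_herm]
lemmas continuous_on_scale [continuous_intros] =
  bounded_bilinear.continuous_on[OF bounded_bilinear_scale]
lemmas has_derivative_scale = bounded_bilinear.FDERIV[OF bounded_bilinear_scale]

lemma one_minus_herm_nonzero:
  assumes "norm z < 1" "norm w \<le> 1"
  shows "1 - herm z w \<noteq> 0"
proof -
  have "cmod (herm z w) \<le> norm z * norm w"
    by (rule Cauchy_Schwarz_herm)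
  also have "\<dots> < 1"
    using assms mult_left_le[of "norm w" "norm z"] by simp
  finally show ?thesis by auto
qed

lemma one_minus_norm_le:
  assumes "norm y \<le> 1"
  shows "1 - norm x \<le> cmod (1 - herm x y)"
proof -
  have "1 - norm x \<le> 1 - cmod (herm x y)"
    using Cauchy_Schwarz_herm[of x y] mult_left_le[of "norm y" "norm x"] assms by simp
  also have "\<dots> \<le> cmod (1 - herm x y)"
    using norm_triangle_ineq2[of 1 "herm x y"] by simp
  finally show ?thesis .
qed

text \<open>The involution of the ball that exchanges \<open>0\<close> and \<open>a\<close>. The usual formula is
  \<open>(a - P z - s (z - P z)) / (1 - \<langle>z,a\<rangle>)\<close> with \<open>s = sqrt (1 - \<bar>a\<bar>\<^sup>2)\<close> and \<open>P\<close> the orthogonal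
  projection to the line of \<open>a\<close>, which has a division by \<open>\<bar>a\<bar>\<^sup>2\<close>. Because
  \<open>1 - s = \<bar>a\<bar>\<^sup>2 / (1 + s)\<close>, one has \<open>(1 - s) P z = \<langle>z,a\<rangle> a / (1 + s)\<close>, and the form used here is
  visibly continuous in \<open>(a, z)\<close>, also at \<open>a = 0\<close>.\<close>

definition mob :: "complex ^ 'n \<Rightarrow> complex ^ 'n \<Rightarrow> complex ^ 'n"
  where "mob a z = (let s = complex_of_real (sqrt (1 - (norm a)\<^sup>2)) in
    (1 / (1 - herm z a)) *s ((1 - herm z a / (1 + s)) *s a - s *s z))"

lemma mob_0 [simp]: "mob a 0 = a"
  by (simp add: mob_def Let_def vec_eq_iff)

lemma mob_scalar_facts:
  assumes "norm a < 1"
  defines "s \<equiv> complex_of_real (sqrt (1 - (norm a)\<^sup>2))"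
  shows "herm a a = 1 - s\<^sup>2" "1 + s \<noteq> 0" "s \<noteq> 0" "cnj s = s"
proof -
  have *: "(norm a)\<^sup>2 < 1"
    using assms by (simp add: power_less_one_iff abs_square_less_1)
  show "herm a a = 1 - s\<^sup>2"
    unfolding s_def herm_self of_real_power[symmetric] using * by simp
  show "s \<noteq> 0" "cnj s = s"
    unfolding s_def using * by simp_all
  have "1 + sqrt (1 - (norm a)\<^sup>2) > 0"
    using * by (smt (verit) real_sqrt_gt_0_iff)
  then show "1 + s \<noteq> 0"
    unfolding s_def by (metis less_irrefl of_real_1 of_real_add of_real_eq_0_iff)
qed

lemma herm_mob:
  assumes a: "norm a < 1" and "norm z < 1"
  shows "1 - herm (mob a z) a = (1 - herm a a) / (1 - herm z a)"
proof -
  define s where "s = complex_of_real (sqrt (1 - (norm a)\<^sup>2))"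
  note s = mob_scalar_facts[OF a, folded s_def]
  have nz: "1 - herm z a \<noteq> 0"
    using assms one_minus_herm_nonzero by (metis less_imp_le)
  have "(1 - herm z a / (1 + s)) * (1 - s\<^sup>2) = 1 - s\<^sup>2 - herm z a * (1 - s)"
    using s(2) by (simp add: field_simps power2_eq_square)
  moreover have "herm (mob a z) a =
      (1 / (1 - herm z a)) * ((1 - herm z a / (1 + s)) * (1 - s\<^sup>2) - s * herm z a)"
    unfolding mob_def Let_def s_def[symmetric] herm_simps s(1) ..
  ultimately have "herm (mob a z) a =
      (1 / (1 - herm z a)) * (1 - s\<^sup>2 - herm z a * (1 - s) - s * herm z a)"
    by simp
  then show ?thesis
    using nz unfolding s(1) by (simp add: field_simps)
qed

lemma mob_mob:
  assumes a: "norm a < 1" and z: "norm z < 1"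
  shows "mob a (mob a z) = z"
proof -
  define s where "s = complex_of_real (sqrt (1 - (norm a)\<^sup>2))"
  note s = mob_scalar_facts[OF a, folded s_def]
  define A where "A = herm z a"
  have nz: "1 - A \<noteq> 0"
    using assms one_minus_herm_nonzero A_def by (metis less_imp_le)
  have h: "1 - herm (mob a z) a = s\<^sup>2 / (1 - A)"
    using herm_mob[OF a z] unfolding A_def s(1) by simp
  then have h': "herm (mob a z) a = 1 - s\<^sup>2 / (1 - A)"
    by (metis add_diff_cancel_left' diff_add_cancel)
  have m: "mob a z = (1 / (1 - A)) *s ((1 - A / (1 + s)) *s a - s *s z)"
    unfolding mob_def Let_def s_def[symmetric] A_def ..
  have "(1 - A) * ((1 + s) - (1 - s\<^sup>2 / (1 - A))) = s * (1 + s - A)"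
    using nz by (simp add: field_simps power2_eq_square)
  then have c: "1 - (1 - s\<^sup>2 / (1 - A)) / (1 + s) = s * (1 / (1 - A)) * (1 - A / (1 + s))"
    using nz s(2) by (simp add: divide_simps) (simp add: algebra_simps)
  have "mob a (mob a z) = (1 / (s\<^sup>2 / (1 - A))) *s
      ((1 - (1 - s\<^sup>2 / (1 - A)) / (1 + s)) *s a - s *s mob a z)"
    unfolding mob_def[of a "mob a z"] Let_def s_def[symmetric] h by (simp only: h')
  also have "\<dots> = (1 / (s\<^sup>2 / (1 - A))) *s (((s * (1 / (1 - A))) * s) *s z)"
    unfolding c m
    by (simp add: vec_eq_iff algebra_simps)
  also have "\<dots> = z"
    using nz s(3) by (simp add: vec_eq_iff power2_eq_square)
  finally show ?thesis .
qed

text \<open>The identity behind every invariance statement: \<open>mob a\<close> changes \<open>1 - \<langle>z,w\<rangle>\<close> only by a factor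
  that splits into a function of \<open>z\<close> and a function of \<open>w\<close>.\<close>

lemma one_minus_herm_mob:
  assumes a: "norm a < 1" and z: "norm z < 1" and w: "norm w < 1"
  shows "1 - herm (mob a z) (mob a w) =
    (1 - herm a a) * (1 - herm z w) / ((1 - herm z a) * (1 - herm a w))"
proof -
  define s where "s = complex_of_real (sqrt (1 - (norm a)\<^sup>2))"
  note s = mob_scalar_facts[OF a, folded s_def]
  define A C Z where "A = herm z a" and "C = herm a w" and "Z = herm z w"
  have nz: "1 - A \<noteq> 0" "1 - C \<noteq> 0"
    using assms one_minus_herm_nonzero A_def C_def by (metis less_imp_le)+
  \<comment> \<open>With \<open>t (1 + s) = 1\<close> in place of a division the identity is polynomial.\<close>
  define t where "t = 1 / (1 + s)"
  have t: "t * (1 + s) = 1"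
    using s(2) by (simp add: t_def)
  have "cnj t = t"
    by (simp add: t_def s(4))
  have CA: "cnj (herm w a) = C"
    by (simp add: C_def cnj_herm)
  define N where "N = (1 - A * t) * (1 - C * t) * (1 - s\<^sup>2) - (1 - A * t) * s * C
      - s * (1 - C * t) * A + s\<^sup>2 * Z"
  have "herm (mob a z) (mob a w) = (1 / (1 - A)) * (1 / (1 - C)) * N"
    unfolding mob_def Let_def s_def[symmetric] A_def[symmetric] divide_inverse N_def
    using \<open>cnj t = t\<close>
    by (simp add: herm_simps s CA t_def C_def[symmetric] Z_def[symmetric] A_def[symmetric]
        divide_inverse algebra_simps power2_eq_square)
  then have "1 - herm (mob a z) (mob a w) = ((1 - A) * (1 - C) - N) / ((1 - A) * (1 - C))"
    using nz by (simp add: diff_divide_distrib)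
  moreover have "(1 - A) * (1 - C) - N = s\<^sup>2 * (1 - Z)"
    unfolding N_def using t by algebra
  ultimately show ?thesis
    unfolding s(1) A_def[symmetric] C_def[symmetric] Z_def[symmetric] by simp
qed

lemma one_minus_norm_mob:
  assumes a: "norm a < 1" and z: "norm z < 1"
  shows "1 - (norm (mob a z))\<^sup>2 = (1 - (norm a)\<^sup>2) * (1 - (norm z)\<^sup>2) / (cmod (1 - herm z a))\<^sup>2"
proof -
  have "(1 - herm z a) * (1 - herm a z) = of_real ((cmod (1 - herm z a))\<^sup>2)"
    using complex_norm_square[of "1 - herm z a"] by (simp add: cnj_herm)
  then have "complex_of_real (1 - (norm (mob a z))\<^sup>2) =
      of_real ((1 - (norm a)\<^sup>2) * (1 - (norm z)\<^sup>2) / (cmod (1 - herm z a))\<^sup>2)"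
    using one_minus_herm_mob[OF a z z] by (simp add: herm_self)
  then show ?thesis
    using of_real_eq_iff by blast
qed

lemma norm_mob_less:
  assumes a: "norm a < 1" and z: "norm z < 1"
  shows "norm (mob a z) < 1"
proof -
  have "0 < cmod (1 - herm z a)"
    using one_minus_herm_nonzero[of z a] assms by auto
  moreover have "0 < 1 - (norm a)\<^sup>2" "0 < 1 - (norm z)\<^sup>2"
    using assms by (simp_all add: abs_square_less_1)
  ultimately have "0 < 1 - (norm (mob a z))\<^sup>2"
    unfolding one_minus_norm_mob[OF assms] by simp
  then show ?thesis
    by (simp add: abs_square_less_1)
qed

lemma mob_self [simp]: "norm a < 1 \<Longrightarrow> mob a a = 0"
  using mob_mob[of a 0] by simp

section \<open>Schwarz lemma, hyperbolic distance and Bergman metric\<close>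

text \<open>Used for derivatives, which are additive as real linear maps.\<close>

definition complex_linear :: "(complex ^ 'm \<Rightarrow> complex ^ 'n) \<Rightarrow> bool"
  where "complex_linear D \<longleftrightarrow> (\<forall>c v. D (c *s v) = c *s D v)"

lemma holomorphic_map_onE:
  assumes "holomorphic_map_on f U" "z \<in> U"
  obtains D where "(f has_derivative D) (at z)" "complex_linear D"
  using assms unfolding holomorphic_map_on_def complex_linear_def by blast

lemma holomorphic_map_on_imp_continuous_on:
  "holomorphic_map_on f U \<Longrightarrow> continuous_on U f"
  unfolding holomorphic_map_on_def
  by (meson continuous_at_imp_continuous_on has_derivative_continuous)

lemma holomorphic_map_on_compose:
  assumes "holomorphic_map_on f U" "holomorphic_map_on g V" "\<And>z. z \<in> U \<Longrightarrow> f z \<in> V"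
  shows "holomorphic_map_on (\<lambda>z. g (f z)) U"
  unfolding holomorphic_map_on_def
proof
  fix z assume z: "z \<in> U"
  obtain D where D: "(f has_derivative D) (at z)" "complex_linear D"
    using assms(1) z by (rule holomorphic_map_onE)
  obtain E where E: "(g has_derivative E) (at (f z))" "complex_linear E"
    using assms(2) assms(3)[OF z] by (rule holomorphic_map_onE)
  have "((\<lambda>z. g (f z)) has_derivative (\<lambda>v. E (D v))) (at z)"
    using has_derivative_compose[OF D(1) E(1)] by simp
  then show "\<exists>D. ((\<lambda>z. g (f z)) has_derivative D) (at z) \<and> (\<forall>c v. D (c *s v) = c *s D v)"
    using D(2) E(2) unfolding complex_linear_def by (intro exI[of _ "\<lambda>v. E (D v)"]) simp
qed

lemma holomorphic_map_on_cong:
  assumes "holomorphic_map_on f U" "open U" "\<And>z. z \<in> U \<Longrightarrow> g z = f z"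
  shows "holomorphic_map_on g U"
  using assms unfolding holomorphic_map_on_def
  by (metis has_derivative_transform_within_open)

lemma holomorphic_mob:
  assumes a: "norm a < 1"
  shows "holomorphic_map_on (mob a) (ball 0 1)"
  unfolding holomorphic_map_on_def
proof
  fix z :: "complex ^ 'a" assume "z \<in> ball 0 1"
  then have z: "norm z < 1" by simp
  define s where "s = complex_of_real (sqrt (1 - (norm a)\<^sup>2))"
  have nz: "1 - herm z a \<noteq> 0"
    using one_minus_herm_nonzero[of z a] a z by simp
  have A: "((\<lambda>z. herm z a) has_derivative (\<lambda>v. herm v a)) (at z)"
    by (rule bounded_linear_imp_has_derivative[OF bounded_linear_herm_left])
  have "((\<lambda>x. 1 / (1 - x)) has_field_derivative (1 / (1 - herm z a)\<^sup>2)) (at (herm z a))"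
    using nz by (auto intro!: derivative_eq_intros simp: power2_eq_square divide_simps)
  then have u: "((\<lambda>z. 1 / (1 - herm z a)) has_derivative (\<lambda>v. 1 / (1 - herm z a)\<^sup>2 * herm v a)) (at z)"
    using has_derivative_compose[OF A] unfolding has_field_derivative_def by fastforce
  have m: "((\<lambda>z. (1 - herm z a / (1 + s)) *s a - s *s z) has_derivative
      (\<lambda>v. (0 - herm v a / (1 + s)) *s a - s *s v)) (at z)"
  proof -
    have "((\<lambda>z. s *s z) has_derivative (\<lambda>v :: complex ^ 'a. s *s v)) (at z)"
      by (rule bounded_linear_imp_has_derivative
          [OF bounded_bilinear.bounded_linear_right[OF bounded_bilinear_scale]])
    moreover have "((\<lambda>z. 1 - herm z a / (1 + s)) has_derivative (\<lambda>v. 0 - herm v a / (1 + s))) (at z)"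
      by (intro has_derivative_diff has_derivative_const
          bounded_linear.has_derivative[OF bounded_linear_divide] A)
    then have "((\<lambda>z. (1 - herm z a / (1 + s)) *s a) has_derivative
        (\<lambda>v. (0 - herm v a / (1 + s)) *s a)) (at z)"
      by (rule bounded_linear.has_derivative
          [OF bounded_bilinear.bounded_linear_left[OF bounded_bilinear_scale]])
    ultimately show ?thesis
      by (intro has_derivative_diff)
  qed
  let ?D = "\<lambda>v. (1 / (1 - herm z a)) *s ((0 - herm v a / (1 + s)) *s a - s *s v)
      + (1 / (1 - herm z a)\<^sup>2 * herm v a) *s ((1 - herm z a / (1 + s)) *s a - s *s z)"
  have "(mob a has_derivative ?D) (at z)"
    using has_derivative_scale[OF u m] unfolding mob_def Let_def s_def .
  moreover have "?D (c *s v) = c *s ?D v" for c v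
    by (simp add: herm_simps vec_eq_iff algebra_simps)
  ultimately show "\<exists>D. (mob a has_derivative D) (at z) \<and> (\<forall>c v. D (c *s v) = c *s D v)"
    by blast
qed

lemma slice_has_field_derivative:
  assumes "(h has_derivative D) (at (\<zeta> *s v))" "complex_linear D"
  shows "((\<lambda>\<zeta>. herm (h (\<zeta> *s v)) e) has_field_derivative herm (D v) e) (at \<zeta>)"
proof -
  have "bounded_linear (\<lambda>\<zeta>. \<zeta> *s v)"
    using bounded_bilinear.bounded_linear_left[OF bounded_bilinear_scale] .
  then have "((\<lambda>\<zeta>. \<zeta> *s v) has_derivative (\<lambda>\<zeta>. \<zeta> *s v)) (at \<zeta>)"
    by (rule bounded_linear_imp_has_derivative)
  from has_derivative_compose[OF this assms(1)]
  have "((\<lambda>\<zeta>. h (\<zeta> *s v)) has_derivative (\<lambda>\<eta>. D (\<eta> *s v))) (at \<zeta>)" .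
  from bounded_linear.has_derivative[OF bounded_linear_herm_left this, of e]
  have "((\<lambda>\<zeta>. herm (h (\<zeta> *s v)) e) has_derivative (\<lambda>\<eta>. herm (D (\<eta> *s v)) e)) (at \<zeta>)" .
  moreover have "(\<lambda>\<eta>. herm (D (\<eta> *s v)) e) = (*) (herm (D v) e)"
    using assms(2) by (simp add: fun_eq_iff complex_linear_def herm_simps)
  ultimately show ?thesis
    unfolding has_field_derivative_def by simp
qed

lemma slice_holomorphic:
  assumes "holomorphic_map_on h (ball 0 1)" "norm v \<le> 1"
  shows "(\<lambda>\<zeta>. herm (h (\<zeta> *s v)) e) holomorphic_on ball 0 1"
proof (rule holomorphic_onI)
  fix \<zeta> :: complex assume "\<zeta> \<in> ball 0 1"
  then have "cmod \<zeta> * norm v < 1"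
    using assms(2) mult_left_le[of "norm v" "cmod \<zeta>"] by simp
  then have "\<zeta> *s v \<in> ball 0 1"
    by (simp add: norm_scale)
  then obtain D where "(h has_derivative D) (at (\<zeta> *s v))" "complex_linear D"
    by (rule holomorphic_map_onE[OF assms(1)])
  then show "(\<lambda>\<zeta>. herm (h (\<zeta> *s v)) e) field_differentiable at \<zeta> within ball 0 1"
    using slice_has_field_derivative field_differentiable_at_within field_differentiable_def by blast
qed

lemma unit_vector_ex:
  fixes v :: "complex ^ 'n"
  obtains e where "norm e = 1" "v = of_real (norm v) *s e"
proof (cases "v = 0")
  case True
  obtain e :: "complex ^ 'n" where "norm e = 1"
    using vector_choose_size[of 1] by auto
  then show ?thesis
    using True that[of e] by (simp add: vec_eq_iff)
next
  case False
  then have "v = of_real (norm v) *s ((1 / norm v) *\<^sub>R v)"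
    by (simp add: scaleR_eq_scale[symmetric])
  with False show ?thesis
    using that[of "(1 / norm v) *\<^sub>R v"] by simp
qed

lemma slice_bound:
  assumes h: "h ` ball 0 1 \<subseteq> ball 0 1" and "norm v \<le> 1" "norm e = 1" "cmod \<zeta> < 1"
  shows "cmod (herm (h (\<zeta> *s v)) e) < 1"
proof -
  have "cmod \<zeta> * norm v < 1"
    using assms mult_left_le[of "norm v" "cmod \<zeta>"] by simp
  then have "norm (h (\<zeta> *s v)) < 1"
    using h by (force simp: norm_scale)
  then show ?thesis
    using Cauchy_Schwarz_herm[of "h (\<zeta> *s v)" e] assms(3) by simp
qed

text \<open>The one-variable Schwarz lemma applies to \<open>\<zeta> \<mapsto> \<langle>h (\<zeta> v), e\<rangle>\<close>, where \<open>v\<close> and \<open>e\<close> are the unit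
  vectors in the directions of \<open>z\<close> and of \<open>h z\<close>.\<close>

lemma Schwarz_ball:
  assumes hol: "holomorphic_map_on h (ball 0 1)" and h: "h ` ball 0 1 \<subseteq> ball 0 1"
    and "h 0 = 0" and z: "norm z < 1"
  shows "norm (h z) \<le> norm z"
proof -
  obtain v where v: "norm v = 1" "z = of_real (norm z) *s v"
    using unit_vector_ex by blast
  obtain e where e: "norm e = 1" "h z = of_real (norm (h z)) *s e"
    using unit_vector_ex by blast
  have "cmod (herm (h (of_real (norm z) *s v)) e) \<le> cmod (of_real (norm z))"
    using v e z \<open>h 0 = 0\<close>
    by (intro Schwarz_Lemma(1)[OF slice_holomorphic[OF hol]] slice_bound[OF h]) auto
  moreover have "herm (h z) e = of_real (norm (h z))"
    using herm_self[of e] e(1) by (subst e(2)) (simp add: herm_simps)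
  ultimately show ?thesis
    using v(2) by simp
qed

text \<open>For a unit vector \<open>v\<close> the slice \<open>\<zeta> \<mapsto> \<langle>h (\<zeta> v), D v\<rangle>\<close> has derivative \<open>1\<close> at \<open>0\<close>, so by
  the equality case of the one-variable Schwarz lemma it is the identity. As \<open>\<bar>h (\<zeta> v)\<bar> \<le> \<bar>\<zeta>\<bar>\<close>, this
  is equality in Cauchy-Schwarz, and \<open>h (\<zeta> v) = \<zeta> D v\<close>.\<close>

lemma Schwarz_ball_equality:
  assumes hol: "holomorphic_map_on h (ball 0 1)" and h: "h ` ball 0 1 \<subseteq> ball 0 1"
    and "h 0 = 0" and D: "(h has_derivative D) (at 0)" "complex_linear D"
    and isom: "\<And>v. norm (D v) = norm v" and z: "norm z < 1"
  shows "h z = D z"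
proof -
  obtain v where v: "norm v = 1" "z = of_real (norm z) *s v"
    using unit_vector_ex by blast
  define k where "k = (\<lambda>\<zeta>. herm (h (\<zeta> *s v)) (D v))"
  have nD: "norm (D v) = 1"
    using isom v by simp
  have hk: "k holomorphic_on ball 0 1"
    unfolding k_def using v by (intro slice_holomorphic hol) simp
  have k0: "k 0 = 0"
    using \<open>h 0 = 0\<close> by (simp add: k_def)
  have kb: "cmod (k \<zeta>) < 1" if "cmod \<zeta> < 1" for \<zeta>
    unfolding k_def using v nD that by (intro slice_bound[OF h]) simp_all
  have d: "(k has_field_derivative 1) (at 0)"
    using slice_has_field_derivative[of h D 0 v "D v"] D herm_self[of "D v"] nD
    by (simp add: k_def)
  then obtain \<alpha> where \<alpha>: "\<And>\<zeta>. cmod \<zeta> < 1 \<Longrightarrow> k \<zeta> = \<alpha> * \<zeta>"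
    using Schwarz_Lemma(3)[OF hk k0 kb, of 0] DERIV_imp_deriv by force
  have "((\<lambda>\<zeta>. \<alpha> * \<zeta>) has_field_derivative 1) (at 0)"
    by (rule DERIV_cong_ev[THEN iffD1, OF refl _ refl d])
       (use \<alpha> in \<open>auto simp: eventually_nhds intro!: exI[of _ "ball 0 1"]\<close>)
  moreover have "((\<lambda>\<zeta>. \<alpha> * \<zeta>) has_field_derivative \<alpha>) (at 0)"
    by (auto intro!: derivative_eq_intros)
  ultimately have "\<alpha> = 1"
    using DERIV_unique by blast
  then have kz: "herm (h z) (D v) = of_real (norm z)"
    using \<alpha>[of "of_real (norm z)"] z v(2) by (simp add: k_def)
  have Dz: "D z = of_real (norm z) *s D v"
    by (subst v(2)) (use D(2) in \<open>simp add: complex_linear_def\<close>)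
  show ?thesis
  proof (rule herm_equality_imp_eq)
    show "herm (h z) (D z) = complex_of_real ((norm (D z))\<^sup>2)"
      unfolding isom unfolding Dz by (simp add: herm_simps kz power2_eq_square)
    show "norm (h z) \<le> norm (D z)"
      unfolding isom using Schwarz_ball[OF hol h \<open>h 0 = 0\<close> z] .
  qed
qed

text \<open>The function \<open>cosh\<^sup>2\<close> of the hyperbolic distance (in a suitable normalisation).\<close>

definition cosh_sq :: "complex ^ 'n \<Rightarrow> complex ^ 'n \<Rightarrow> real"
  where "cosh_sq z w = (cmod (1 - herm z w))\<^sup>2 / ((1 - (norm z)\<^sup>2) * (1 - (norm w)\<^sup>2))"

text \<open>The Bergman metric of the ball, up to a constant factor.\<close>

definition bergman :: "complex ^ 'n \<Rightarrow> complex ^ 'n \<Rightarrow> real"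
  where "bergman z v = (norm v)\<^sup>2 / (1 - (norm z)\<^sup>2) +
    (cmod (herm v z))\<^sup>2 / (1 - (norm z)\<^sup>2)\<^sup>2"

lemma bergman_0 [simp]: "bergman 0 v = (norm v)\<^sup>2"
  by (simp add: bergman_def)

lemma one_minus_norm_sq_pos: "norm z < 1 \<Longrightarrow> 0 < 1 - (norm z)\<^sup>2"
  by (simp add: abs_square_less_1)

text \<open>Since \<open>1 / cosh_sq x y = 1 - \<bar>mob y x\<bar>\<^sup>2\<close>, this is the Schwarz lemma for \<open>h\<close> composed with the
  involutions that move \<open>w\<close> and \<open>h w\<close> to the origin.\<close>

lemma Schwarz_Pick:
  assumes hol: "holomorphic_map_on h (ball 0 1)" and h: "h ` ball 0 1 \<subseteq> ball 0 1"
    and z: "norm z < 1" and w: "norm w < 1"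
  shows "cosh_sq (h z) (h w) \<le> cosh_sq z w"
proof -
  have hz: "norm (h z) < 1" if "norm z < 1" for z
    using h that by force
  have eq: "cosh_sq x y = 1 / (1 - (norm (mob y x))\<^sup>2)" if "norm x < 1" "norm y < 1"
    for x y :: "complex ^ 'k"
    unfolding one_minus_norm_mob[OF that(2,1)] cosh_sq_def by (simp add: mult.commute)
  let ?g = "\<lambda>\<zeta>. mob (h w) (h (mob w \<zeta>))"
  have "norm (?g (mob w z)) \<le> norm (mob w z)"
  proof (rule Schwarz_ball)
    show "holomorphic_map_on ?g (ball 0 1)"
    proof (rule holomorphic_map_on_compose[OF _ holomorphic_mob])
      show "holomorphic_map_on (\<lambda>\<zeta>. h (mob w \<zeta>)) (ball 0 1)"
        using norm_mob_less[OF w] by (intro holomorphic_map_on_compose[OF holomorphic_mob[OF w] hol]) simp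
    qed (use w hz norm_mob_less in auto)
    show "?g ` ball 0 1 \<subseteq> ball 0 1"
    proof safe
      fix \<zeta> :: "complex ^ 'a" assume "\<zeta> \<in> ball 0 1"
      then have "norm (h (mob w \<zeta>)) < 1"
        using hz norm_mob_less[OF w] by simp
      then show "?g \<zeta> \<in> ball 0 1"
        using norm_mob_less[OF hz[OF w]] by simp
    qed
    show "?g 0 = 0" "norm (mob w z) < 1"
      using w z hz norm_mob_less by auto
  qed
  then have "norm (mob (h w) (h z)) \<le> norm (mob w z)"
    by (simp add: mob_mob w z)
  then have "(norm (mob (h w) (h z)))\<^sup>2 \<le> (norm (mob w z))\<^sup>2"
    by (rule power_mono) simp
  then show ?thesis
    using eq[OF z w] eq[OF hz[OF z] hz[OF w]]
      one_minus_norm_sq_pos[OF norm_mob_less[OF w z]]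
    by (simp add: frac_le)
qed

text \<open>The numerator is quadratic in \<open>w - z\<close>; up to a factor it is the Bergman metric at
  \<open>z\<close>, evaluated on \<open>w - z\<close>.\<close>

lemma cosh_sq_minus_one:
  assumes "norm z < 1" "norm w < 1"
  shows "cosh_sq w z - 1 = ((cmod (herm (w - z) z))\<^sup>2 + (norm (w - z))\<^sup>2 * (1 - (norm z)\<^sup>2))
    / ((1 - (norm w)\<^sup>2) * (1 - (norm z)\<^sup>2))"
proof -
  define u where "u = w - z"
  define H where "H = herm u z"
  define r where "r = 1 - (norm z)\<^sup>2"
  have w: "w = z + u"
    by (simp add: u_def)
  have 1: "1 - herm w z = of_real r - H"
    by (simp add: w herm_simps herm_self H_def r_def)
  have 2: "1 - (norm w)\<^sup>2 = r - 2 * Re H - (norm u)\<^sup>2"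
    by (simp add: w r_def H_def Re_herm power2_norm_eq_inner inner_add inner_commute)
  have 3: "(cmod (of_real r - H))\<^sup>2 = r\<^sup>2 - 2 * r * Re H + (cmod H)\<^sup>2"
    unfolding cmod_power2 by (simp add: power2_eq_square algebra_simps)
  have "(1 - (norm w)\<^sup>2) * r \<noteq> 0"
    using one_minus_norm_sq_pos assms r_def by fastforce
  moreover have "r\<^sup>2 - 2 * r * Re H + (cmod H)\<^sup>2 - (1 - (norm w)\<^sup>2) * r
      = (cmod H)\<^sup>2 + (norm u)\<^sup>2 * r"
    unfolding 2 by (simp add: algebra_simps power2_eq_square)
  ultimately show ?thesis
    unfolding cosh_sq_def u_def[symmetric] H_def[symmetric] r_def[symmetric] 1 3
    by (metis diff_divide_distrib divide_self)
qed

lemma bergman_as_limit: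
  assumes k: "(k has_vector_derivative v) (at 0)" and k0: "norm (k 0) < 1"
  shows "((\<lambda>t. (cosh_sq (k t) (k 0) - 1) / t\<^sup>2) \<longlongrightarrow> bergman (k 0) v) (at (0::real))"
proof -
  define r where "r = 1 - (norm (k 0))\<^sup>2"
  have r: "r > 0"
    using one_minus_norm_sq_pos[OF k0] by (simp add: r_def)
  have cont: "(k \<longlongrightarrow> k 0) (at 0)"
    using has_vector_derivative_continuous[OF k] by (simp add: continuous_at)
  have quot: "((\<lambda>t. (k t - k 0) /\<^sub>R t) \<longlongrightarrow> v) (at 0)"
  proof (rule LIM_zero_cancel, rule tendsto_norm_zero_cancel)
    have "((\<lambda>t. norm (k (0 + t) - k 0 - t *\<^sub>R v) / norm t) \<longlongrightarrow> 0) (at 0)"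
      using k unfolding has_vector_derivative_def has_derivative_at by blast
    moreover have "\<forall>\<^sub>F t in at 0. norm (k (0 + t) - k 0 - t *\<^sub>R v) / norm t
        = norm ((k t - k 0) /\<^sub>R t - v)"
    proof (rule eventually_at_filter[THEN iffD2], intro always_eventually allI impI)
      fix t :: real assume "t \<noteq> 0"
      then have "k t - k 0 - t *\<^sub>R v = t *\<^sub>R ((k t - k 0) /\<^sub>R t - v)"
        by (simp add: scaleR_diff_right)
      then show "norm (k (0 + t) - k 0 - t *\<^sub>R v) / norm t = norm ((k t - k 0) /\<^sub>R t - v)"
        using \<open>t \<noteq> 0\<close> by simp
    qed
    ultimately show "((\<lambda>t. norm ((k t - k 0) /\<^sub>R t - v)) \<longlongrightarrow> 0) (at 0)"
      by (rule Lim_transform_eventually)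
  qed
  have "((\<lambda>t. (1 - (norm (k t))\<^sup>2) * r) \<longlongrightarrow> r * r) (at 0)"
    unfolding r_def by (intro tendsto_intros cont)
  then have "((\<lambda>t. ((cmod (herm ((k t - k 0) /\<^sub>R t) (k 0)))\<^sup>2 + (norm ((k t - k 0) /\<^sub>R t))\<^sup>2 * r)
      / ((1 - (norm (k t))\<^sup>2) * r)) \<longlongrightarrow> ((cmod (herm v (k 0)))\<^sup>2 + (norm v)\<^sup>2 * r) / (r * r)) (at 0)"
    using r by (intro tendsto_divide[OF tendsto_add[OF tendsto_power[OF tendsto_norm
          [OF tendsto_herm[OF quot tendsto_const]]] tendsto_mult[OF tendsto_power
          [OF tendsto_norm[OF quot]] tendsto_const]]]) auto
  moreover have "((cmod (herm v (k 0)))\<^sup>2 + (norm v)\<^sup>2 * r) / (r * r) = bergman (k 0) v"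
    using r unfolding bergman_def r_def[symmetric] by (simp add: field_simps power2_eq_square)
  moreover have "\<forall>\<^sub>F t in at 0.
      ((cmod (herm ((k t - k 0) /\<^sub>R t) (k 0)))\<^sup>2 + (norm ((k t - k 0) /\<^sub>R t))\<^sup>2 * r)
      / ((1 - (norm (k t))\<^sup>2) * r) = (cosh_sq (k t) (k 0) - 1) / t\<^sup>2"
  proof -
    have "\<forall>\<^sub>F t in at 0. norm (k t) < 1"
      using order_tendstoD(2)[OF tendsto_norm[OF cont] k0] .
    moreover have "\<forall>\<^sub>F t in at (0::real). t \<noteq> 0"
      by (simp add: eventually_at_filter)
    ultimately show ?thesis
    proof eventually_elim
      case (elim t)
      have [simp]: "cmod (inverse (of_real t)) = inverse \<bar>t\<bar>"
        by (simp add: norm_inverse)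
      have "(cmod (herm ((k t - k 0) /\<^sub>R t) (k 0)))\<^sup>2 = (cmod (herm (k t - k 0) (k 0)))\<^sup>2 / t\<^sup>2"
        "(norm ((k t - k 0) /\<^sub>R t))\<^sup>2 = (norm (k t - k 0))\<^sup>2 / t\<^sup>2"
        unfolding herm_scaleR_left norm_scaleR
        by (simp_all add: power_mult_distrib power_inverse divide_inverse)
      then show ?case
        unfolding cosh_sq_minus_one[OF k0 elim(1)] r_def[symmetric]
        by (simp add: add_divide_distrib mult.commute)
    qed
  qed
  ultimately show ?thesis
    using Lim_transform_eventually by fastforce
qed

text \<open>The Bergman metric is the second-order term of \<open>cosh_sq\<close> on the diagonal, so the inequality
  follows from that for \<open>cosh_sq\<close> by passing to the limit.\<close>

lemma Schwarz_Pick_infinitesimal: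
  assumes hol: "holomorphic_map_on h (ball 0 1)" and h: "h ` ball 0 1 \<subseteq> ball 0 1"
    and z: "norm z < 1" and D: "(h has_derivative D) (at z)"
  shows "bergman (h z) (D v) \<le> bergman z v"
proof -
  let ?k = "\<lambda>t. z + t *\<^sub>R v"
  have k: "(?k has_vector_derivative v) (at 0)"
    by (auto intro!: derivative_eq_intros)
  have hk: "((\<lambda>t. h (?k t)) has_vector_derivative D v) (at 0)"
  proof -
    have "(?k has_derivative (\<lambda>t. t *\<^sub>R v)) (at 0)"
      using k by (simp add: has_vector_derivative_def)
    then have "((\<lambda>t. h (?k t)) has_derivative (\<lambda>t. D (t *\<^sub>R v))) (at 0)"
      by (rule has_derivative_compose) (use D in simp)
    then show ?thesis
      using linear_simps(5)[OF has_derivative_bounded_linear[OF D]]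
      unfolding has_vector_derivative_def by simp
  qed
  have ev: "\<forall>\<^sub>F t in at 0. norm (?k t) < 1"
    using z by (intro order_tendstoD(2)[of _ "norm z"]) (auto intro!: tendsto_eq_intros)
  have l1: "((\<lambda>t. (cosh_sq (?k t) z - 1) / t\<^sup>2) \<longlongrightarrow> bergman z v) (at 0)"
    using bergman_as_limit[OF k] z by simp
  have l2: "((\<lambda>t. (cosh_sq (h (?k t)) (h z) - 1) / t\<^sup>2) \<longlongrightarrow> bergman (h z) (D v)) (at 0)"
    using bergman_as_limit[OF hk] h z by force
  show ?thesis
  proof (rule tendsto_le[OF _ l1 l2])
    show "\<forall>\<^sub>F t in at 0. (cosh_sq (h (?k t)) (h z) - 1) / t\<^sup>2 \<le> (cosh_sq (?k t) z - 1) / t\<^sup>2"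
      using ev
    proof eventually_elim
      case (elim t)
      show ?case
        using Schwarz_Pick[OF hol h elim z] by (simp add: divide_right_mono)
    qed
  qed simp
qed

lemma AutD:
  assumes "\<phi> \<in> Aut (ball 0 1)"
  shows "holomorphic_map_on \<phi> (ball 0 1)" "\<phi> ` ball 0 1 = ball 0 1" "inj_on \<phi> (ball 0 1)"
    "holomorphic_map_on (inv_into (ball 0 1) \<phi>) (ball 0 1)"
    "inv_into (ball 0 1) \<phi> ` ball 0 1 = ball 0 1"
    "\<phi> \<in> extensional (ball 0 1)"
proof -
  have "bij_betw \<phi> (ball 0 1) (ball 0 1)"
    using assms by (simp add: Aut_def)
  from this bij_betw_inv_into[OF this]
  show "\<phi> ` ball 0 1 = ball 0 1" "inj_on \<phi> (ball 0 1)"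
    "inv_into (ball 0 1) \<phi> ` ball 0 1 = ball 0 1"
    by (simp_all add: bij_betw_def)
qed (use assms in \<open>simp_all add: Aut_def\<close>)

text \<open>The inverse map is given explicitly, so that its holomorphy need not be discussed in terms of
  \<open>inv_into\<close>.\<close>

lemma AutI:
  assumes "holomorphic_map_on h (ball 0 1)" "holomorphic_map_on k (ball 0 1)"
    and "\<And>z. norm z < 1 \<Longrightarrow> norm (h z) < 1" "\<And>z. norm z < 1 \<Longrightarrow> norm (k z) < 1"
    and "\<And>z. norm z < 1 \<Longrightarrow> k (h z) = z" "\<And>z. norm z < 1 \<Longrightarrow> h (k z) = z"
  shows "restrict h (ball 0 1) \<in> Aut (ball 0 1)"
proof -
  let ?h = "restrict h (ball 0 1)"
  have bij: "bij_betw ?h (ball 0 1) (ball 0 1)"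
    by (rule bij_betw_byWitness[where f'=k]) (use assms in auto)
  have "inv_into (ball 0 1) ?h z = k z" if "z \<in> ball 0 1" for z
    by (rule inv_into_f_eq) (use bij assms that in \<open>auto simp: bij_betw_def\<close>)
  then have "holomorphic_map_on (inv_into (ball 0 1) ?h) (ball 0 1)"
    by (intro holomorphic_map_on_cong[OF assms(2)]) auto
  moreover have "holomorphic_map_on ?h (ball 0 1)"
    by (rule holomorphic_map_on_cong[OF assms(1)]) auto
  ultimately show ?thesis
    using bij unfolding Aut_def by auto
qed

text \<open>The infinitesimal Schwarz-Pick inequality holds for the map and for its inverse.\<close>

lemma Aut_bergman:
  assumes \<phi>: "\<phi> \<in> Aut (ball 0 1)" and z: "norm z < 1" and D: "(\<phi> has_derivative D) (at z)"
  shows "bergman (\<phi> z) (D v) = bergman z v"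
proof (rule antisym)
  note A = AutD[OF \<phi>]
  show "bergman (\<phi> z) (D v) \<le> bergman z v"
    using Schwarz_Pick_infinitesimal[OF A(1) _ z D] A(2) by blast
  let ?\<psi> = "inv_into (ball 0 1) \<phi>"
  have \<phi>z: "norm (\<phi> z) < 1"
    using A(2) z by force
  then obtain E where E: "(?\<psi> has_derivative E) (at (\<phi> z))"
    using holomorphic_map_onE[OF A(4)] by (metis mem_ball_0)
  have inv: "?\<psi> (\<phi> z) = z" if "norm z < 1" for z
    using A(3) that by (simp add: inv_into_f_f)
  have "((\<lambda>z. ?\<psi> (\<phi> z)) has_derivative (\<lambda>v. E (D v))) (at z)"
    using has_derivative_compose[OF D E] .
  then have "((\<lambda>z. z) has_derivative (\<lambda>v. E (D v))) (at z)"
    by (rule has_derivative_transform_within_open[where s="ball 0 1"]) (use z inv in auto)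
  then have "E (D v) = v"
    using has_derivative_unique[OF has_derivative_ident] by metis
  then show "bergman z v \<le> bergman (\<phi> z) (D v)"
    using Schwarz_Pick_infinitesimal[OF A(4) _ \<phi>z E, of "D v"] A(5) inv[OF z] by simp
qed

section \<open>The automorphism group of the ball\<close>

lemma complex_linear_matrix:
  fixes D :: "complex ^ 'm \<Rightarrow> complex ^ 'n"
  assumes "bounded_linear D" "complex_linear D"
  shows "matrix D *v x = D x"
proof (rule matrix_works)
  show "Vector_Spaces.linear (*s) (*s) D"
    unfolding Vector_Spaces.linear_iff
    using assms linear_add[OF bounded_linear.linear]
    by (auto simp: complex_linear_def vec.vector_space_axioms)
qed

lemma bounded_linear_matrix:
  fixes A :: "complex ^ 'm ^ 'n"
  shows "bounded_linear (\<lambda>v. A *v v)"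
  unfolding linear_conv_bounded_linear[symmetric]
  by (rule linearI) (simp_all add: matrix_vector_right_distrib scaleR_eq_scale vector_scalar_commute)

lemma holomorphic_matrix: "holomorphic_map_on (\<lambda>z. A *v z) U"
  unfolding holomorphic_map_on_def
  using bounded_linear_imp_has_derivative[OF bounded_linear_matrix[of A]] vector_scalar_commute
  by metis

definition isometric_matrix :: "complex ^ 'm ^ 'n \<Rightarrow> bool"
  where "isometric_matrix A \<longleftrightarrow> (\<forall>v. norm (A *v v) = norm v)"

lemma isometric_matrix_inverse:
  fixes A :: "complex ^ 'n ^ 'n"
  assumes "isometric_matrix A"
  obtains B where "A ** B = mat 1" "B ** A = mat 1" "isometric_matrix B"
proof -
  have "\<forall>x. A *v x = 0 \<longrightarrow> x = 0"
    using assms unfolding isometric_matrix_def by (metis norm_eq_zero)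
  then obtain B where B: "B ** A = mat 1"
    using matrix_left_invertible_ker by blast
  then have B': "A ** B = mat 1"
    using matrix_left_right_inverse by blast
  have "norm (B *v v) = norm v" for v
  proof -
    have "norm (B *v v) = norm (A *v (B *v v))"
      using assms by (simp add: isometric_matrix_def)
    then show ?thesis
      by (simp add: matrix_vector_mul_assoc B' )
  qed
  then show ?thesis
    using B B' that by (simp add: isometric_matrix_def)
qed

lemma mob_Aut:
  assumes "norm a < 1"
  shows "restrict (mob a) (ball 0 1) \<in> Aut (ball 0 1)"
  using assms norm_mob_less mob_mob by (intro AutI[where k="mob a"] holomorphic_mob) auto

lemma mob_bergman:
  assumes "norm a < 1" "norm z < 1" "(mob a has_derivative D) (at z)"
  shows "bergman (mob a z) (D v) = bergman z v"
proof -
  have "(restrict (mob a) (ball 0 1) has_derivative D) (at z)"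
    by (rule has_derivative_transform_within_open[OF assms(3), where s="ball 0 1"])
       (use assms in auto)
  from Aut_bergman[OF mob_Aut[OF assms(1)] assms(2) this, of v] assms(2)
  show ?thesis by simp
qed

definition unitary_mob :: "(complex ^ 'n ^ 'n) \<times> (complex ^ 'n) \<Rightarrow> complex ^ 'n \<Rightarrow> complex ^ 'n"
  where "unitary_mob p z = fst p *v mob (snd p) z"

text \<open>Every automorphism is an isometric matrix after an involution. The next two sets are the
  parameters with \<open>\<bar>a\<bar> \<le> r\<close>, which are compact for all \<open>r\<close>, and all admissible parameters. They
  give access to compactness in the automorphism group without normal families.\<close>

definition Aut_parameters :: "real \<Rightarrow> ((complex ^ 'n ^ 'n) \<times> (complex ^ 'n)) set"
  where "Aut_parameters r = Collect isometric_matrix \<times> cball 0 r"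

definition open_Aut_parameters :: "((complex ^ 'n ^ 'n) \<times> (complex ^ 'n)) set"
  where "open_Aut_parameters = Collect isometric_matrix \<times> ball 0 1"

lemma norm_unitary_mob:
  "p \<in> open_Aut_parameters \<Longrightarrow> norm (unitary_mob p z) = norm (mob (snd p) z)"
  by (auto simp: unitary_mob_def open_Aut_parameters_def isometric_matrix_def)

lemma unitary_mob_in_Aut:
  assumes p: "p \<in> open_Aut_parameters"
  shows "restrict (unitary_mob p) (ball 0 1) \<in> Aut (ball 0 1)"
proof -
  obtain A a where [simp]: "p = (A, a)" and A: "isometric_matrix A" and a: "norm a < 1"
    using p by (auto simp: open_Aut_parameters_def)
  obtain B where B: "A ** B = mat 1" "B ** A = mat 1" "isometric_matrix B"
    using isometric_matrix_inverse[OF A] .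
  have nB: "norm (B *v z) = norm z" and nA: "norm (A *v z) = norm z" for z
    using B(3) A by (auto simp: isometric_matrix_def)
  show ?thesis
  proof (rule AutI[where k="\<lambda>z. mob a (B *v z)"])
    show "holomorphic_map_on (unitary_mob p) (ball 0 1)"
      unfolding unitary_mob_def
      by (rule holomorphic_map_on_compose[OF holomorphic_mob holomorphic_matrix, of _ UNIV])
         (use a in auto)
    show "holomorphic_map_on (\<lambda>z. mob a (B *v z)) (ball 0 1)"
      by (rule holomorphic_map_on_compose[OF holomorphic_matrix holomorphic_mob[OF a]])
         (auto simp: nB)
  qed (use a B(1,2) in \<open>auto simp: unitary_mob_def nA nB norm_mob_less mob_mob matrix_vector_mul_assoc\<close>)
qed

text \<open>If \<open>\<phi> a = 0\<close>, then \<open>\<phi> \<circ> mob a\<close> fixes the origin and preserves the Bergman metric there,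
  that is, the norm. The equality case of the Schwarz lemma makes it linear.\<close>

lemma Aut_representation:
  assumes \<phi>: "\<phi> \<in> Aut (ball 0 1)"
  obtains p where "p \<in> open_Aut_parameters" "\<phi> = restrict (unitary_mob p) (ball 0 1)"
proof -
  note A = AutD[OF \<phi>]
  obtain a where a: "norm a < 1" "\<phi> a = 0"
  proof -
    have "0 \<in> \<phi> ` ball 0 1"
      unfolding A(2) by simp
    then show ?thesis
      using that by (metis imageE mem_ball_0)
  qed
  define h where "h = (\<lambda>z. \<phi> (mob a z))"
  have hol: "holomorphic_map_on h (ball 0 1)"
    unfolding h_def
    by (rule holomorphic_map_on_compose[OF holomorphic_mob[OF a(1)] A(1)])
       (use norm_mob_less[OF a(1)] in auto)
  have ball: "h ` ball 0 1 \<subseteq> ball 0 1"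
    using A(2) norm_mob_less[OF a(1)] by (force simp: h_def)
  obtain M where M: "(mob a has_derivative M) (at 0)" "complex_linear M"
    by (rule holomorphic_map_onE[OF holomorphic_mob[OF a(1)], of 0]) auto
  obtain E where E: "(\<phi> has_derivative E) (at a)" "complex_linear E"
    using holomorphic_map_onE[OF A(1), of a] a(1) by auto
  define D where "D = (\<lambda>v. E (M v))"
  have D: "(h has_derivative D) (at 0)"
    unfolding h_def D_def by (rule has_derivative_compose[OF M(1)]) (use E in simp)
  have lin: "complex_linear D"
    using E M by (simp add: D_def complex_linear_def)
  have isom: "norm (D v) = norm v" for v
  proof -
    have "(norm (D v))\<^sup>2 = bergman (\<phi> a) (E (M v))"
      by (simp add: a D_def)
    also have "\<dots> = bergman (mob a 0) (M v)"
      using Aut_bergman[OF \<phi> a(1) E(1)] by simp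
    also have "\<dots> = (norm v)\<^sup>2"
      using mob_bergman[OF a(1) _ M(1)] by simp
    finally show ?thesis by simp
  qed
  have h0: "h 0 = 0"
    by (simp add: h_def a)
  note mat = complex_linear_matrix[OF has_derivative_bounded_linear[OF D] lin]
  let ?p = "(matrix D, a)"
  have "\<phi> z = unitary_mob ?p z" if z: "norm z < 1" for z
  proof -
    have "\<phi> z = h (mob a z)"
      by (simp add: h_def mob_mob a z)
    also have "\<dots> = D (mob a z)"
      by (rule Schwarz_ball_equality[OF hol ball h0 D lin isom norm_mob_less[OF a(1) z]])
    finally show ?thesis
      by (simp add: unitary_mob_def mat)
  qed
  then have "\<phi> = restrict (unitary_mob ?p) (ball 0 1)"
    using A(6) by (intro extensionalityI[of _ "ball 0 1"]) auto
  moreover have "?p \<in> open_Aut_parameters"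
    by (simp add: open_Aut_parameters_def isometric_matrix_def mat isom a)
  ultimately show ?thesis
    using that by blast
qed

lemma continuous_on_unitary_mob:
  "continuous_on (open_Aut_parameters \<times> ball 0 1) (\<lambda>(p, z). unitary_mob p z)"
proof -
  have nz: "1 - herm (snd q) (snd (fst q)) \<noteq> 0"
    "1 + complex_of_real (sqrt (1 - (norm (snd (fst q)))\<^sup>2)) \<noteq> 0"
    if "q \<in> open_Aut_parameters \<times> ball 0 1" for q :: "((complex ^ 'a ^ 'a) \<times> (complex ^ 'a)) \<times> (complex ^ 'a)"
    using that mob_scalar_facts(2)[of "snd (fst q)"] one_minus_herm_nonzero[of "snd q" "snd (fst q)"]
    by (auto simp: open_Aut_parameters_def)
  have "continuous_on (open_Aut_parameters \<times> ball 0 1)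
      (\<lambda>q. fst (fst q) *v mob (snd (fst q)) (snd q) :: complex ^ 'a)"
    unfolding matrix_vector_mult_def mob_def Let_def
    by (intro continuous_intros) (use nz in auto)
  then show ?thesis
    by (simp add: unitary_mob_def case_prod_unfold)
qed

lemma continuous_on_unitary_mob':
  assumes "continuous_on T p" "continuous_on T q" "p ` T \<subseteq> open_Aut_parameters" "q ` T \<subseteq> ball 0 1"
  shows "continuous_on T (\<lambda>x. unitary_mob (p x) (q x))"
  using continuous_on_compose2[OF continuous_on_unitary_mob continuous_on_Pair[OF assms(1,2)]]
    assms(3,4) by fastforce

lemma compact_Aut_parameters: "compact (Aut_parameters r)"
proof -
  have "closed {A :: complex ^ 'n ^ 'n. \<forall>v. norm (A *v v) = norm v}"
    unfolding matrix_vector_mult_def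
    by (intro closed_Collect_all closed_Collect_eq continuous_intros)
  moreover have "bounded (Collect isometric_matrix :: (complex ^ 'n ^ 'n) set)"
  proof (rule boundedI)
    fix A :: "complex ^ 'n ^ 'n" assume "A \<in> Collect isometric_matrix"
    then have A: "norm (A *v v) = norm v" for v
      by (simp add: isometric_matrix_def)
    have entry: "cmod (A $ i $ j) \<le> 1" for i j
    proof -
      have "A $ i $ j = (A *v axis j 1) $ i"
        by (simp add: matrix_vector_mult_def axis_def if_distrib[of "(*) _"] cong: if_cong)
      also have "cmod \<dots> \<le> norm (A *v axis j 1)"
        by (rule Finite_Cartesian_Product.norm_nth_le)
      finally show ?thesis
        using norm_Basis[of "axis j (1 :: complex)"] by (simp add: A axis_in_Basis_iff Basis_complex_def)
    qed
    have "norm A \<le> (\<Sum>i\<in>UNIV. norm (A $ i))"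
      unfolding norm_vec_def by (rule L2_set_le_sum) simp
    also have "\<dots> \<le> (\<Sum>i\<in>(UNIV :: 'n set). \<Sum>j\<in>(UNIV :: 'n set). 1)"
    proof (rule sum_mono)
      fix i
      have "norm (A $ i) \<le> (\<Sum>j\<in>UNIV. norm (A $ i $ j))"
        unfolding norm_vec_def[of "A $ i"] by (rule L2_set_le_sum) simp
      also have "\<dots> \<le> (\<Sum>j\<in>(UNIV :: 'n set). 1)"
        by (rule sum_mono) (rule entry)
      finally show "norm (A $ i) \<le> (\<Sum>j\<in>(UNIV :: 'n set). 1)" .
    qed
    finally show "norm A \<le> (\<Sum>i\<in>(UNIV :: 'n set). \<Sum>j\<in>(UNIV :: 'n set). 1)" .
  qed
  ultimately have "compact (Collect isometric_matrix :: (complex ^ 'n ^ 'n) set)"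
    unfolding isometric_matrix_def compact_eq_bounded_closed by blast
  then show ?thesis
    unfolding Aut_parameters_def by (intro compact_Times compact_cball)
qed

text \<open>The complement is the projection of a relatively closed set along the compact factor \<open>K\<close>.\<close>

lemma openin_forall_compact_less:
  fixes F :: "'a::topological_space \<Rightarrow> 'b::topological_space \<Rightarrow> real"
  assumes K: "compact K" and F: "continuous_on (S \<times> K) (\<lambda>(x, z). F x z)"
  shows "openin (top_of_set S) {x\<in>S. \<forall>z\<in>K. F x z < e}"
proof -
  define C where "C = (S \<times> K) \<inter> (\<lambda>(x, z). F x z) -` {e..}"
  have "closedin (top_of_set (S \<times> K)) C"
    unfolding C_def by (intro continuous_closedin_preimage F) simp
  then have "closedin (prod_topology (top_of_set S) (top_of_set K)) C"
    by (simp add: subtopology_Times[symmetric] euclidean_product_topology)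
  moreover have "closed_map (prod_topology (top_of_set S) (top_of_set K)) (top_of_set S) fst"
    using K by (intro closed_map_fst) (simp add: compact_space_subtopology)
  ultimately have "closedin (top_of_set S) (fst ` C)"
    by (simp add: closed_map_def)
  then have "openin (top_of_set S) (S - fst ` C)"
    by (metis openin_diff openin_topspace topspace_euclidean_subtopology)
  moreover have "S - fst ` C = {x\<in>S. \<forall>z\<in>K. F x z < e}"
    by (force simp: C_def)
  ultimately show ?thesis by simp
qed

lemma continuous_map_unitary_mob:
  "continuous_map (top_of_set open_Aut_parameters) (Aut_topology (ball 0 1))
    (\<lambda>p. restrict (unitary_mob p) (ball 0 1))"
    (is "continuous_map _ _ ?\<Phi>")
  unfolding Aut_topology_def continuous_on_generated_topo_iff
proof (intro conjI allI impI)
  fix U :: "(complex ^ 'a \<Rightarrow> complex ^ 'a) set"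
  assume "U \<in> {{\<psi> \<in> Aut (ball 0 1). \<forall>z\<in>K. dist (\<psi> z) (\<phi> z) < e} | \<phi> K e.
      \<phi> \<in> Aut (ball 0 1) \<and> compact K \<and> K \<subseteq> ball 0 1 \<and> 0 < e}"
  then obtain \<phi> K e where U: "U = {\<psi> \<in> Aut (ball 0 1). \<forall>z\<in>K. dist (\<psi> z) (\<phi> z) < e}"
    and \<phi>: "\<phi> \<in> Aut (ball 0 1)" and K: "compact K" "K \<subseteq> ball 0 1" by blast
  have "?\<Phi> -` U \<inter> open_Aut_parameters =
      {p \<in> open_Aut_parameters. \<forall>z\<in>K. dist (unitary_mob p z) (\<phi> z) < e}"
    using unitary_mob_in_Aut K(2) unfolding U by (auto simp: subset_iff)
  moreover have "continuous_on (open_Aut_parameters \<times> K) (\<lambda>(p, z). dist (unitary_mob p z) (\<phi> z))"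
  proof -
    have "continuous_on (open_Aut_parameters \<times> K) (\<lambda>q. unitary_mob (fst q) (snd q))"
      using K(2) by (intro continuous_on_unitary_mob' continuous_intros) auto
    moreover have "continuous_on (open_Aut_parameters \<times> K) (\<lambda>q. \<phi> (snd q))"
      by (rule continuous_on_compose2[OF holomorphic_map_on_imp_continuous_on[OF AutD(1)[OF \<phi>]]])
         (use K(2) in \<open>auto intro: continuous_intros\<close>)
    ultimately show ?thesis
      unfolding case_prod_unfold by (intro continuous_intros)
  qed
  ultimately show "openin (top_of_set open_Aut_parameters)
      (?\<Phi> -` U \<inter> topspace (top_of_set open_Aut_parameters))"
    using openin_forall_compact_less[OF K(1)] by simp
next
  show "?\<Phi> ` topspace (top_of_set open_Aut_parameters) \<subseteq>
    \<Union> {{\<psi> \<in> Aut (ball 0 1). \<forall>z\<in>K. dist (\<psi> z) (\<phi> z) < e} | \<phi> K e.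
      \<phi> \<in> Aut (ball 0 1) \<and> compact K \<and> K \<subseteq> ball 0 1 \<and> 0 < e}"
    unfolding topspace_Aut_topology[of "ball 0 1", unfolded Aut_topology_def topology_generated_by_topspace]
    using unitary_mob_in_Aut by auto
qed

text \<open>The bound on \<open>\<phi> 0\<close> bounds \<open>\<psi> (f 0) = f (\<phi> 0)\<close> away from the sphere, hence also the parameter
  of \<open>\<psi>\<close>. So the group is a continuous image of a closed subset of a compact set of parameters.
  In the contrapositive form, non-compactness produces automorphisms \<open>\<phi>\<close> of the group with \<open>\<phi> 0\<close>
  arbitrarily close to the sphere.\<close>

lemma compact_G_topology:
  fixes f :: "complex ^ 'm \<Rightarrow> complex ^ 'n"
  assumes hol: "holomorphic_map_on f (ball 0 1)" and f: "f ` ball 0 1 \<subseteq> ball 0 1"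
    and r: "0 \<le> r" "r < 1" and bound: "\<And>\<phi> \<psi>. (\<phi>, \<psi>) \<in> G_group f \<Longrightarrow> norm (\<phi> 0) \<le> r"
  shows "compact_space (G_topology f)"
proof -
  have contf: "continuous_on (ball 0 1) f"
    using hol by (rule holomorphic_map_on_imp_continuous_on)
  have nf: "norm (f z) < 1" if "norm z < 1" for z
    using f that by force
  obtain R where R: "R < 1" "\<And>z. norm z \<le> r \<Longrightarrow> norm (f z) \<le> R"
  proof -
    have "continuous_on (cball 0 r) (\<lambda>z. norm (f z))"
      using r by (intro continuous_on_norm continuous_on_subset[OF contf]) auto
    then obtain x where "x \<in> cball 0 r" "\<And>z. z \<in> cball 0 r \<Longrightarrow> norm (f z) \<le> norm (f x)"
      using continuous_attains_sup[of "cball 0 r" "\<lambda>z. norm (f z)"] r by auto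
    then show ?thesis
      using that[of "norm (f x)"] nf[of x] r by auto
  qed
  have R0: "0 \<le> R"
    using R(2)[of 0] r by (smt (verit) norm_ge_zero norm_zero)
  \<comment> \<open>The parameter \<open>b\<close> of \<open>\<psi>\<close> satisfies \<open>1 - \<bar>b\<bar>\<^sup>2 \<ge> \<kappa>\<close>, by the formula for \<open>1 - \<bar>mob b (f 0)\<bar>\<^sup>2\<close>.\<close>
  define \<kappa> where "\<kappa> = (1 - R\<^sup>2) * (1 - norm (f 0))\<^sup>2"
  have \<kappa>: "0 < \<kappa>"
    using R(1) R0 nf[of 0] by (simp add: \<kappa>_def abs_square_less_1)
  define r' where "r' = sqrt (1 - \<kappa>)"
  have r': "r' < 1"
    using \<kappa> by (simp add: r'_def)
  have bound_b: "norm b \<le> r'" if b: "norm b < 1" "norm (mob b (f 0)) \<le> R" for b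
  proof -
    have f0: "norm (f 0) < 1"
      using nf by simp
    have d: "(1 - norm (f 0))\<^sup>2 \<le> (cmod (1 - herm (f 0) b))\<^sup>2"
      using f0 b one_minus_norm_le[of b "f 0"] by (intro power_mono) auto
    have dpos: "0 < (1 - norm (f 0))\<^sup>2"
      using f0 by simp
    have "1 - R\<^sup>2 \<le> 1 - (norm (mob b (f 0)))\<^sup>2"
      using b by (simp add: power_mono)
    also have "\<dots> = (1 - (norm b)\<^sup>2) * (1 - (norm (f 0))\<^sup>2) / (cmod (1 - herm (f 0) b))\<^sup>2"
      using one_minus_norm_mob[OF b(1) f0] .
    also have "\<dots> \<le> (1 - (norm b)\<^sup>2) * 1 / (1 - norm (f 0))\<^sup>2"
      using d dpos one_minus_norm_sq_pos[OF b(1)] one_minus_norm_sq_pos[OF f0]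
      by (intro frac_le mult_left_mono) auto
    finally have "\<kappa> \<le> 1 - (norm b)\<^sup>2"
      using dpos by (simp add: \<kappa>_def field_simps)
    then show ?thesis
      unfolding r'_def by (intro real_le_rsqrt) simp
  qed
  define Q where "Q = (Aut_parameters r :: ((complex ^ 'm ^ 'm) \<times> _) set)
    \<times> (Aut_parameters r' :: ((complex ^ 'n ^ 'n) \<times> _) set)"
  have Qsub: "fst q \<in> open_Aut_parameters" "snd q \<in> open_Aut_parameters" if "q \<in> Q" for q
    using that r r' by (auto simp: Q_def Aut_parameters_def open_Aut_parameters_def)
  have ball_unitary_mob: "norm (unitary_mob p z) < 1"
    if "p \<in> open_Aut_parameters" "norm z < 1" for p and z :: "complex ^ 'k"
    using that norm_unitary_mob[OF that(1), of z] norm_mob_less[of "snd p" z]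
    by (auto simp: open_Aut_parameters_def)
  define P where "P = {q \<in> Q. \<forall>z\<in>ball 0 1. unitary_mob (snd q) (f z) = f (unitary_mob (fst q) z)}"
  have "compact P"
  proof -
    have Q: "compact Q"
      unfolding Q_def by (intro compact_Times compact_Aut_parameters)
    have "closed (Q \<inter> (\<lambda>q. unitary_mob (snd q) (f z) - f (unitary_mob (fst q) z)) -` {0})"
      if z: "z \<in> ball 0 1" for z
    proof (intro continuous_closed_preimage continuous_on_diff)
      show "continuous_on Q (\<lambda>q. unitary_mob (snd q) (f z))"
        using Qsub nf z by (intro continuous_on_unitary_mob' continuous_intros) auto
      have "continuous_on Q (\<lambda>q. unitary_mob (fst q) z)"
        using Qsub z by (intro continuous_on_unitary_mob' continuous_intros) auto
      then show "continuous_on Q (\<lambda>q. f (unitary_mob (fst q) z))"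
        by (rule continuous_on_compose2[OF contf]) (use ball_unitary_mob[OF Qsub(1), of _ z] z in auto)
    qed (use Q compact_imp_closed in auto)
    then have "closed (\<Inter>z\<in>ball 0 1.
        Q \<inter> (\<lambda>q. unitary_mob (snd q) (f z) - f (unitary_mob (fst q) z)) -` {0})"
      by (intro closed_INT ballI)
    from compact_Int_closed[OF Q this] show ?thesis
      by (rule back_subst[of compact]) (auto simp: P_def)
  qed
  then have "compactin (prod_topology (top_of_set open_Aut_parameters) (top_of_set open_Aut_parameters)) P"
    unfolding prod_topology_subtopology_eu compactin_subtopology compactin_euclidean_iff
    using Qsub by (auto simp: P_def mem_Times_iff)
  moreover have "continuous_map
      (prod_topology (top_of_set open_Aut_parameters) (top_of_set open_Aut_parameters))
      (prod_topology (Aut_topology (ball 0 1)) (Aut_topology (ball 0 1)))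
      (\<lambda>(p, q). (restrict (unitary_mob p) (ball 0 1), restrict (unitary_mob q) (ball 0 1)))"
    unfolding continuous_map_prod_top
    by (intro disjI2 conjI continuous_map_unitary_mob)
  ultimately have c: "compactin (prod_topology (Aut_topology (ball 0 1)) (Aut_topology (ball 0 1)))
      ((\<lambda>(p, q). (restrict (unitary_mob p) (ball 0 1), restrict (unitary_mob q) (ball 0 1))) ` P)"
    by (rule image_compactin)
  have "(\<lambda>(p, q). (restrict (unitary_mob p) (ball 0 1), restrict (unitary_mob q) (ball 0 1))) ` P
      = G_group f"
  proof (intro equalityI subsetI)
    fix x assume "x \<in> (\<lambda>(p, q). (restrict (unitary_mob p) (ball 0 1), restrict (unitary_mob q) (ball 0 1))) ` P"
    then obtain p q where pq: "(p, q) \<in> P"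
      "x = (restrict (unitary_mob p) (ball 0 1), restrict (unitary_mob q) (ball 0 1))" by auto
    then show "x \<in> G_group f"
      using Qsub[of "(p, q)"] unitary_mob_in_Aut[of p] unitary_mob_in_Aut[of q] nf
      by (auto simp: G_group_def P_def)
  next
    fix x assume x: "x \<in> G_group f"
    then obtain \<phi> \<psi> where [simp]: "x = (\<phi>, \<psi>)" and \<phi>: "\<phi> \<in> Aut (ball 0 1)" and \<psi>: "\<psi> \<in> Aut (ball 0 1)"
      and eq: "\<And>z. norm z < 1 \<Longrightarrow> \<psi> (f z) = f (\<phi> z)"
      by (auto simp: G_group_def)
    obtain p where p: "p \<in> open_Aut_parameters" "\<phi> = restrict (unitary_mob p) (ball 0 1)"
      using Aut_representation[OF \<phi>] .
    obtain q where q: "q \<in> open_Aut_parameters" "\<psi> = restrict (unitary_mob q) (ball 0 1)"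
      using Aut_representation[OF \<psi>] .
    have \<phi>0: "norm (\<phi> 0) \<le> r"
      using bound x by simp
    have "norm (snd p) \<le> r"
      using \<phi>0 norm_unitary_mob[OF p(1), of 0] p(2) by simp
    moreover have "norm (mob (snd q) (f 0)) \<le> R"
      using R(2)[OF \<phi>0] eq[of 0] norm_unitary_mob[OF q(1), of "f 0"] q(2) nf[of 0] by simp
    then have "norm (snd q) \<le> r'"
      using q(1) by (intro bound_b) (auto simp: open_Aut_parameters_def)
    ultimately have "(p, q) \<in> P"
      using p q eq nf by (force simp: P_def Q_def Aut_parameters_def open_Aut_parameters_def)
    then show "x \<in> (\<lambda>(p, q). (restrict (unitary_mob p) (ball 0 1), restrict (unitary_mob q) (ball 0 1))) ` P"
      using p q by force
  qed
  with c show ?thesis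
    unfolding G_topology_def by (simp add: compact_space_subtopology)
qed

section \<open>First and second order conditions at the boundary\<close>

text \<open>A boundary point lemma with an explicit constant, read off from the Schwarz-Pick inequality for
  the pair \<open>0\<close>, \<open>z\<close>. It makes the normal derivative at the boundary strictly positive.\<close>

lemma Hopf_ball:
  assumes hol: "holomorphic_map_on f (ball 0 1)" and f: "f ` ball 0 1 \<subseteq> ball 0 1"
    and z: "norm z < 1"
  shows "(1 - norm (f 0))\<^sup>2 * (1 - (norm z)\<^sup>2) \<le> 1 - (norm (f z))\<^sup>2"
proof -
  have nf: "norm (f z) < 1" "norm (f 0) < 1"
    using image_subset_iff[THEN iffD1, OF f] z by simp_all
  have r: "0 < 1 - (norm z)\<^sup>2" "0 < 1 - (norm (f z))\<^sup>2" "0 < 1 - (norm (f 0))\<^sup>2"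
    using one_minus_norm_sq_pos z nf by blast+
  have "(1 - norm (f 0))\<^sup>2 \<le> (cmod (1 - herm (f 0) (f z)))\<^sup>2"
    using one_minus_norm_le[of "f z" "f 0"] nf by (intro power_mono) auto
  also have "\<dots> = cosh_sq (f 0) (f z) * ((1 - (norm (f 0))\<^sup>2) * (1 - (norm (f z))\<^sup>2))"
    using r by (simp add: cosh_sq_def)
  also have "\<dots> \<le> cosh_sq 0 z * (1 * (1 - (norm (f z))\<^sup>2))"
    using Schwarz_Pick[OF hol f _ z, of 0] r
    by (intro mult_mono) (auto simp: cosh_sq_def)
  also have "\<dots> = (1 - (norm (f z))\<^sup>2) / (1 - (norm z)\<^sup>2)"
    by (simp add: cosh_sq_def)
  finally show ?thesis
    using r by (simp add: pos_le_divide_eq)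
qed

lemma has_vector_derivative_chain_blinfun:
  assumes "(\<gamma> has_vector_derivative d) (at t)" "(h has_derivative blinfun_apply H) (at (\<gamma> t))"
  shows "((\<lambda>t. h (\<gamma> t)) has_vector_derivative H d) (at t)"
  using has_derivative_compose[OF assms(1)[unfolded has_vector_derivative_def] assms(2)]
  by (simp add: has_vector_derivative_def blinfun.scaleR_right)

text \<open>A self-contained description of the situation near a boundary point: \<open>g\<close> is the \<open>C\<^sup>2\<close> extension
  of \<open>f\<close> across a piece \<open>U\<close> of the sphere, with derivatives \<open>g'\<close> and \<open>g''\<close>. Outside the closed
  ball \<open>g\<close> is not related to \<open>f\<close>.\<close>

locale boundary_extension =
  fixes f g :: "complex ^ 'm \<Rightarrow> complex ^ 'n"
    and g' :: "complex ^ 'm \<Rightarrow> (complex ^ 'm) \<Rightarrow>\<^sub>L (complex ^ 'n)"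
    and g'' :: "complex ^ 'm \<Rightarrow> (complex ^ 'm) \<Rightarrow>\<^sub>L ((complex ^ 'm) \<Rightarrow>\<^sub>L (complex ^ 'n))"
    and U :: "(complex ^ 'm) set"
  assumes hol: "holomorphic_map_on f (ball 0 1)" and maps: "f ` ball 0 1 \<subseteq> ball 0 1"
    and U: "open U"
    and g': "\<And>x. x \<in> U \<Longrightarrow> (g has_derivative blinfun_apply (g' x)) (at x)"
    and g'': "\<And>x. x \<in> U \<Longrightarrow> (g' has_derivative blinfun_apply (g'' x)) (at x)"
    and cont_g'': "continuous_on U g''"
    and eq: "\<And>z. z \<in> U \<Longrightarrow> norm z < 1 \<Longrightarrow> g z = f z"
    and sphere: "\<And>q. q \<in> U \<Longrightarrow> norm q = 1 \<Longrightarrow> norm (g q) = 1"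
begin

lemma cont_g: "continuous_on U g" and cont_g': "continuous_on U g'"
  by (auto intro!: continuous_at_imp_continuous_on has_derivative_continuous[OF g']
      has_derivative_continuous[OF g''])

lemma f_deriv:
  assumes "z \<in> U" "norm z < 1"
  shows "(f has_derivative g' z) (at z)"
  by (rule has_derivative_transform_within_open[OF g'[OF assms(1)], where s="U \<inter> ball 0 1"])
     (use assms U eq in auto)

text \<open>Identities that hold inside the ball extend to the boundary by radial limits.\<close>

lemma vanishes_on_boundary:
  fixes F :: "complex ^ 'm \<Rightarrow> 'b :: real_normed_vector"
  assumes F: "continuous_on U F" and zero: "\<And>z. z \<in> U \<Longrightarrow> norm z < 1 \<Longrightarrow> F z = 0"
    and q: "q \<in> U" "norm q \<le> 1"
  shows "F q = 0"
proof -
  have t: "((\<lambda>t. t *\<^sub>R q) \<longlongrightarrow> 1 *\<^sub>R q) (at_left 1)"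
    by (intro tendsto_intros)
  have "(F \<longlongrightarrow> F q) (nhds q)"
    using F U q(1) continuous_on_eq_continuous_at continuous_at isCont_def
    by (metis tendsto_at_iff_tendsto_nhds)
  then have "((\<lambda>t. F (t *\<^sub>R q)) \<longlongrightarrow> F q) (at_left 1)"
    by (rule filterlim_compose) (use t in simp)
  moreover have "\<forall>\<^sub>F t in at_left 1. t *\<^sub>R q \<in> U"
    using topological_tendstoD[OF t U] q by simp
  then have "\<forall>\<^sub>F t in at_left 1. F (t *\<^sub>R q) = 0"
    using eventually_at_left_real[of 0 1, simplified]
  proof eventually_elim
    case (elim t)
    have "norm (t *\<^sub>R q) \<le> t"
      using elim(2) q(2) by (simp add: mult_left_le)
    then have "norm (t *\<^sub>R q) < 1"
      using elim(2) by linarith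
    then show ?case
      using zero elim(1) by blast
  qed
  then have "((\<lambda>t. F (t *\<^sub>R q)) \<longlongrightarrow> 0) (at_left 1)"
    by (rule tendsto_eventually)
  ultimately show ?thesis
    by (rule tendsto_unique[OF trivial_limit_at_left_real])
qed

lemma g'_complex_linear:
  assumes q: "q \<in> U" "norm q \<le> 1"
  shows "g' q (c *s v) = c *s g' q v"
proof -
  have "g' q (c *s v) - c *s g' q v = 0"
  proof (rule vanishes_on_boundary[OF _ _ q])
    show "continuous_on U (\<lambda>q. g' q (c *s v) - c *s g' q v)"
      by (intro continuous_intros cont_g')
    fix z assume z: "z \<in> U" "norm z < 1"
    obtain D where D: "(f has_derivative D) (at z)" "complex_linear D"
      using holomorphic_map_onE[OF hol, of z] z(2) by auto
    have "D = g' z"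
      using has_derivative_unique[OF D(1) f_deriv[OF z]] .
    then show "g' z (c *s v) - c *s g' z v = 0"
      using D(2) by (simp add: complex_linear_def)
  qed
  then show ?thesis by simp
qed

lemma g''_complex_linear_right:
  assumes z: "z \<in> U" "norm z < 1"
  shows "g'' z w (c *s v) = c *s g'' z w v"
proof -
  have 1: "((\<lambda>x. g' x (c *s v)) has_derivative (\<lambda>w. g'' z w (c *s v))) (at z)"
    by (rule bounded_linear.has_derivative[OF blinfun.bounded_linear_left g''[OF z(1)]])
  have 2: "((\<lambda>x. c *s g' x v) has_derivative (\<lambda>w. c *s g'' z w v)) (at z)"
    by (intro bounded_linear.has_derivative[OF blinfun.bounded_linear_left g''[OF z(1)]]
        bounded_linear.has_derivative[OF bounded_bilinear.bounded_linear_right[OF bounded_bilinear_scale]])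
  have "((\<lambda>x. g' x (c *s v)) has_derivative (\<lambda>w. c *s g'' z w v)) (at z)"
    by (rule has_derivative_transform_within_open[OF 2, where s="U \<inter> ball 0 1"])
       (use z U g'_complex_linear in auto)
  from has_derivative_unique[OF 1 this] show ?thesis by metis
qed

lemma herm_ext: "(\<And>e. herm x e = herm y e) \<Longrightarrow> x = y"
  using herm_self[of "x - y"] by (simp add: herm_simps)

text \<open>On the slice \<open>\<zeta> \<mapsto> z + \<zeta> u\<close> each component of \<open>f\<close> is holomorphic, hence so is its derivative
  \<open>\<langle>g' (z + \<zeta> u) u, e\<rangle>\<close>. The real derivative of this function at \<open>0\<close> is therefore complex linear.\<close>

lemma g''_complex_linear_left:
  assumes z: "z \<in> U" "norm z < 1"
  shows "g'' z (\<i> *s u) u = \<i> *s g'' z u u"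
proof (rule herm_ext)
  fix e
  let ?V = "(\<lambda>\<zeta>. z + \<zeta> *s u) -` (U \<inter> ball 0 1)"
  let ?k = "\<lambda>\<zeta>. herm (f (z + \<zeta> *s u)) e"
  have V: "open ?V"
    using U by (intro open_vimage open_Int) (auto intro!: continuous_intros)
  have k: "(?k has_field_derivative herm (g' (z + \<zeta> *s u) u) e) (at \<zeta>)" if "\<zeta> \<in> ?V" for \<zeta>
  proof -
    have in_U: "z + \<zeta> *s u \<in> U" "norm (z + \<zeta> *s u) < 1"
      using that by auto
    have "((\<lambda>x. z + x) has_derivative (\<lambda>x. x)) (at (\<zeta> *s u))"
      by (auto intro!: derivative_eq_intros)
    then have "((\<lambda>x. f (z + x)) has_derivative g' (z + \<zeta> *s u)) (at (\<zeta> *s u))"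
      by (rule has_derivative_compose) (rule f_deriv[OF in_U])
    then show ?thesis
      by (rule slice_has_field_derivative)
         (use g'_complex_linear in_U in \<open>simp add: complex_linear_def\<close>)
  qed
  then have "?k holomorphic_on ?V"
    by (intro holomorphic_onI) (meson field_differentiable_at_within field_differentiable_def)
  then have "deriv ?k holomorphic_on ?V"
    using V by (rule holomorphic_deriv)
  moreover have V0: "0 \<in> ?V"
    using z by simp
  ultimately obtain c where c: "(deriv ?k has_field_derivative c) (at 0)"
    using V by (meson field_differentiable_def holomorphic_on_imp_differentiable_at)
  have "((\<lambda>\<zeta>. herm (g' (z + \<zeta> *s u) u) e) has_derivative (*) c) (at 0)"
    by (rule has_derivative_transform_within_open[OF c[unfolded has_field_derivative_def] V V0])
       (use k DERIV_imp_deriv in blast)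
  moreover have "((\<lambda>\<zeta>. herm (g' (z + \<zeta> *s u) u) e) has_derivative
      (\<lambda>\<eta>. herm (g'' z (\<eta> *s u) u) e)) (at 0)"
  proof -
    have "((\<lambda>\<zeta>. z + \<zeta> *s u) has_derivative (\<lambda>\<eta>. 0 + \<eta> *s u)) (at 0)"
      by (intro has_derivative_add has_derivative_const bounded_linear_imp_has_derivative
          [OF bounded_bilinear.bounded_linear_left[OF bounded_bilinear_scale]])
    then have "((\<lambda>\<zeta>. z + \<zeta> *s u) has_derivative (\<lambda>\<eta>. \<eta> *s u)) (at 0)"
      by simp
    then have "((\<lambda>\<zeta>. g' (z + \<zeta> *s u)) has_derivative (\<lambda>\<eta>. g'' z (\<eta> *s u))) (at 0)"
      by (rule has_derivative_compose) (use g'' z in simp)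
    then show ?thesis
      by (intro bounded_linear.has_derivative[OF bounded_linear_herm_left]
          bounded_linear.has_derivative[OF blinfun.bounded_linear_left])
  qed
  ultimately have "(*) c = (\<lambda>\<eta>. herm (g'' z (\<eta> *s u) u) e)"
    by (rule has_derivative_unique)
  then have *: "herm (g'' z (\<eta> *s u) u) e = c * \<eta>" for \<eta>
    by metis
  have "1 *s u = u"
    by (simp add: vec_eq_iff)
  then show "herm (g'' z (\<i> *s u) u) e = herm (\<i> *s g'' z u u) e"
    using *[of 1] *[of \<i>] by (simp add: herm_simps)
qed

text \<open>The second derivative of a holomorphic map is complex bilinear, and \<open>g''\<close> inherits this on the
  sphere by continuity.\<close>

lemma g''_rotate:
  assumes q: "q \<in> U" "norm q \<le> 1"
  shows "g'' q (\<i> *s u) (\<i> *s u) = - g'' q u u"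
proof -
  have "g'' q (\<i> *s u) (\<i> *s u) + g'' q u u = 0"
  proof (rule vanishes_on_boundary[OF _ _ q])
    show "continuous_on U (\<lambda>q. g'' q (\<i> *s u) (\<i> *s u) + g'' q u u)"
      by (intro continuous_intros cont_g'')
    fix z assume "z \<in> U" "norm z < 1"
    then show "g'' z (\<i> *s u) (\<i> *s u) + g'' z u u = 0"
      by (simp add: g''_complex_linear_right g''_complex_linear_left vec_eq_iff
          mult.assoc[symmetric])
  qed
  then show ?thesis
    by (simp add: add_eq_0_iff2)
qed

text \<open>The normal derivative of \<open>\<bar>g\<bar>\<^sup>2 / 2\<close> at a boundary point.\<close>

definition lam :: "complex ^ 'm \<Rightarrow> real"
  where "lam q = g' q q \<bullet> g q"

text \<open>Both conditions say that \<open>\<bar>g\<bar>\<^sup>2 = 1\<close> along the great circle through \<open>q\<close> in direction \<open>u\<close>: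
  they are the first and the second derivative of this equation. The term \<open>lam q\<close> comes from the
  curvature of the circle, whose second derivative at \<open>q\<close> is \<open>- q\<close>.\<close>

lemma
  assumes q: "q \<in> U" "norm q = 1" and u: "norm u = 1" "u \<bullet> q = 0"
  shows tangent_first_order: "g' q u \<bullet> g q = 0"
    and tangent_second_order: "g'' q u u \<bullet> g q + (norm (g' q u))\<^sup>2 = lam q"
proof -
  define \<gamma> where "\<gamma> = (\<lambda>t. cos t *\<^sub>R q + sin t *\<^sub>R u)"
  define d where "d = (\<lambda>t. cos t *\<^sub>R u - sin t *\<^sub>R q)"
  have \<gamma>: "(\<gamma> has_vector_derivative d t) (at t)" for t
    unfolding \<gamma>_def d_def has_vector_derivative_def
    by (auto intro!: derivative_eq_intros simp: algebra_simps)
  have d: "(d has_vector_derivative - \<gamma> t) (at t)" for t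
    unfolding \<gamma>_def d_def has_vector_derivative_def
    by (auto intro!: derivative_eq_intros simp: algebra_simps)
  have norm_\<gamma>: "norm (\<gamma> t) = 1" for t
  proof -
    have "q \<bullet> q = 1" "u \<bullet> u = 1" "q \<bullet> u = 0"
      using q u by (simp_all add: norm_eq_1 inner_commute)
    then have "\<gamma> t \<bullet> \<gamma> t = (cos t)\<^sup>2 + (sin t)\<^sup>2"
      using u(2) unfolding \<gamma>_def by (simp add: inner_add power2_eq_square)
    then show ?thesis
      by (simp add: norm_eq_1)
  qed
  define T where "T = \<gamma> -` U"
  have T: "open T"
    unfolding T_def \<gamma>_def using U by (intro open_vimage) (auto intro!: continuous_intros)
  have T0: "0 \<in> T" and [simp]: "\<gamma> 0 = q" "d 0 = u"
    using q(1) by (simp_all add: T_def \<gamma>_def d_def)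
  have gd: "((\<lambda>t. g (\<gamma> t)) has_vector_derivative g' (\<gamma> t) (d t)) (at t)" if "t \<in> T" for t
    using that by (intro has_vector_derivative_chain_blinfun[OF \<gamma>] g') (simp add: T_def)
  \<comment> \<open>Half the derivative of \<open>\<bar>g (\<gamma> t)\<bar>\<^sup>2\<close>; it vanishes near \<open>0\<close>, so it can be differentiated once more.\<close>
  define k where "k = (\<lambda>t. g' (\<gamma> t) (d t) \<bullet> g (\<gamma> t))"
  have k0: "k t = 0" if t: "t \<in> T" for t
  proof -
    have "((\<lambda>t. g (\<gamma> t) \<bullet> g (\<gamma> t)) has_vector_derivative
        (g (\<gamma> t) \<bullet> g' (\<gamma> t) (d t) + g' (\<gamma> t) (d t) \<bullet> g (\<gamma> t))) (at t)"
      by (rule bounded_bilinear.has_vector_derivative[OF bounded_bilinear_inner gd[OF t] gd[OF t]])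
    moreover have "((\<lambda>t. g (\<gamma> t) \<bullet> g (\<gamma> t)) has_vector_derivative 0) (at t)"
      by (rule has_vector_derivative_transform_within_open[OF has_vector_derivative_const[of 1] T t])
         (use sphere norm_\<gamma> in \<open>auto simp: T_def norm_eq_1[symmetric]\<close>)
    ultimately show ?thesis
      using vector_derivative_unique_at by (fastforce simp: k_def inner_commute)
  qed
  show "g' q u \<bullet> g q = 0"
    using k0[OF T0] by (simp add: k_def)
  have g'd: "((\<lambda>t. g' (\<gamma> t)) has_vector_derivative g'' q u) (at 0)"
    using has_vector_derivative_chain_blinfun[OF \<gamma>[of 0], of g'] g''[OF q(1)] by simp
  have "((\<lambda>t. g' (\<gamma> t) (d t)) has_vector_derivative (g' q (- q) + g'' q u u)) (at 0)"
    using bounded_bilinear.has_vector_derivative[OF bounded_bilinear_blinfun_apply g'd d] by simp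
  from bounded_bilinear.has_vector_derivative[OF bounded_bilinear_inner this gd[OF T0]]
  have "(k has_vector_derivative
      (g' q u \<bullet> g' q u + (g' q (- q) + g'' q u u) \<bullet> g q)) (at 0)"
    by (simp add: k_def)
  moreover have "(k has_vector_derivative 0) (at 0)"
    by (rule has_vector_derivative_transform_within_open[OF has_vector_derivative_const T T0])
       (use k0 in simp)
  ultimately have "g' q u \<bullet> g' q u + (g' q (- q) + g'' q u u) \<bullet> g q = 0"
    using vector_derivative_unique_at by blast
  then show "g'' q u u \<bullet> g q + (norm (g' q u))\<^sup>2 = lam q"
    by (simp add: lam_def power2_norm_eq_inner inner_add_left inner_diff_left
        blinfun.minus_right)
qed

text \<open>The tangential derivative of \<open>\<bar>g\<bar>\<^sup>2\<close> vanishes on the sphere, which gives the formula for the real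
  inner product. Complex linearity of \<open>g' q\<close> upgrades it to the Hermitian product.\<close>

lemma herm_boundary_derivative:
  assumes q: "q \<in> U" "norm q = 1"
  shows "herm (g' q v) (g q) = of_real (lam q) * herm v q"
proof -
  have real: "g' q v \<bullet> g q = lam q * (v \<bullet> q)" for v
  proof -
    define u where "u = v - (v \<bullet> q) *\<^sub>R q"
    have uq: "u \<bullet> q = 0"
      using q by (simp add: u_def inner_diff_left norm_eq_1)
    have "g' q u \<bullet> g q = 0"
    proof (cases "u = 0")
      case False
      have "g' q ((1 / norm u) *\<^sub>R u) \<bullet> g q = 0"
        using False uq by (intro tangent_first_order[OF q]) simp_all
      then show ?thesis
        using False by (simp add: blinfun.scaleR_right)
    qed (simp add: blinfun.zero_right)
    then show ?thesis
      by (simp add: u_def blinfun.diff_right blinfun.scaleR_right inner_diff_left lam_def)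
  qed
  show ?thesis
    unfolding herm_eq_inner g'_complex_linear[OF q(1) eq_refl[OF q(2)], symmetric] real
    by (simp add: complex_eq_iff)
qed

text \<open>On the complex tangent space \<open>g' q\<close> multiplies all squared norms by the normal derivative.
  Both \<open>u\<close> and \<open>\<i> u\<close> are tangent to the sphere, and adding the second-order conditions in these two
  directions cancels the contribution of \<open>g''\<close>.\<close>

lemma norm_boundary_derivative:
  assumes q: "q \<in> U" "norm q = 1" and u: "herm u q = 0"
  shows "(norm (g' q u))\<^sup>2 = lam q * (norm u)\<^sup>2"
proof -
  have unit: "(norm (g' q u))\<^sup>2 = lam q" if u: "herm u q = 0" "norm u = 1" for u
  proof -
    have 1: "u \<bullet> q = 0" "(\<i> *s u) \<bullet> q = 0"
      using u unfolding Re_herm[symmetric] by (simp_all add: herm_simps)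
    have n: "norm (\<i> *s u) = 1"
      by (simp add: norm_scale u)
    have "norm (g' q (\<i> *s u)) = norm (g' q u)"
      using q by (simp add: g'_complex_linear norm_scale)
    then show ?thesis
      using tangent_second_order[OF q u(2) 1(1)] tangent_second_order[OF q n 1(2)]
        g''_rotate[OF q(1), of u] q(2) by simp
  qed
  show ?thesis
  proof (cases "u = 0")
    case False
    have "(norm (g' q ((1 / norm u) *\<^sub>R u)))\<^sup>2 = lam q"
      using False u by (intro unit) (simp_all add: herm_scaleR_left)
    then show ?thesis
      using False by (simp add: blinfun.scaleR_right power_mult_distrib field_simps)
  qed (simp add: blinfun.zero_right)
qed

end

section \<open>Asymptotic isometry at the boundary\<close>

text \<open>Used for the extension \<open>g\<close> and, since that is \<open>C\<^sup>2\<close>, also for its derivative.\<close>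

lemma C1_locally_Lipschitz:
  fixes h :: "'a::real_normed_vector \<Rightarrow> 'b::real_normed_vector" and h' :: "'a \<Rightarrow> 'a \<Rightarrow>\<^sub>L 'b"
  assumes U: "open U" and h: "\<And>x. x \<in> U \<Longrightarrow> (h has_derivative blinfun_apply (h' x)) (at x)"
    and h': "continuous_on U h'" and p: "p \<in> U"
  obtains \<epsilon> C where "0 < \<epsilon>" "ball p \<epsilon> \<subseteq> U" "\<And>x. x \<in> ball p \<epsilon> \<Longrightarrow> norm (h' x) \<le> C"
    "\<And>x y. x \<in> ball p \<epsilon> \<Longrightarrow> y \<in> ball p \<epsilon> \<Longrightarrow> norm (h x - h y) \<le> C * norm (x - y)"
proof -
  obtain \<delta> where \<delta>: "0 < \<delta>" "ball p \<delta> \<subseteq> U"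
    using U p open_contains_ball by blast
  have "isCont h' p"
    using h' U p continuous_on_eq_continuous_at by blast
  then obtain \<eta> where \<eta>: "0 < \<eta>" "\<And>x. dist x p < \<eta> \<Longrightarrow> dist (h' x) (h' p) < 1"
    unfolding continuous_at_eps_delta by (metis zero_less_one)
  define \<epsilon> where "\<epsilon> = min \<delta> \<eta>"
  have sub: "ball p \<epsilon> \<subseteq> U"
    using \<delta> by (auto simp: \<epsilon>_def)
  have bound: "norm (h' x) \<le> norm (h' p) + 1" if "x \<in> ball p \<epsilon>" for x
  proof -
    have "norm (h' x - h' p) < 1"
      using \<eta>(2)[of x] that by (simp add: \<epsilon>_def dist_norm norm_minus_commute)
    then show ?thesis
      using norm_triangle_ineq2[of "h' x" "h' p"] by simp
  qed
  have "norm (h x - h y) \<le> (norm (h' p) + 1) * norm (x - y)"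
    if "x \<in> ball p \<epsilon>" "y \<in> ball p \<epsilon>" for x y
  proof (rule differentiable_bound[OF convex_ball[of p \<epsilon>] _ _ that])
    fix x assume x: "x \<in> ball p \<epsilon>"
    then show "(h has_derivative blinfun_apply (h' x)) (at x within ball p \<epsilon>)"
      using h sub has_derivative_at_withinI by blast
    show "onorm (blinfun_apply (h' x)) \<le> norm (h' p) + 1"
      using bound[OF x] by (simp add: norm_blinfun.rep_eq)
  qed
  then show ?thesis
    using that[of \<epsilon> "norm (h' p) + 1"] sub bound \<delta>(1) \<eta>(1) by (simp add: \<epsilon>_def)
qed

context boundary_extension
begin

lemma norm_sq_mean_value:
  assumes seg: "closed_segment w q \<subseteq> U"
  shows "\<exists>\<xi>\<in>closed_segment w q. (norm (g q))\<^sup>2 - (norm (g w))\<^sup>2 = 2 * (g' \<xi> (q - w) \<bullet> g \<xi>)"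
proof -
  define \<gamma> where "\<gamma> = (\<lambda>t. (1 - t) *\<^sub>R w + t *\<^sub>R q)"
  have \<gamma>: "\<gamma> t \<in> closed_segment w q" if "0 \<le> t" "t \<le> 1" for t
    using that unfolding \<gamma>_def in_segment by blast
  have "((\<lambda>t. (norm (g (\<gamma> t)))\<^sup>2) has_real_derivative 2 * (g' (\<gamma> t) (q - w) \<bullet> g (\<gamma> t))) (at t)"
    if "0 \<le> t" "t \<le> 1" for t
  proof -
    have "(\<gamma> has_vector_derivative (q - w)) (at t)"
      unfolding \<gamma>_def has_vector_derivative_def
      by (auto intro!: derivative_eq_intros simp: algebra_simps)
    from has_vector_derivative_chain_blinfun[OF this, of g] g' \<gamma>[OF that] seg
    have "((\<lambda>t. g (\<gamma> t)) has_vector_derivative g' (\<gamma> t) (q - w)) (at t)" by blast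
    from bounded_bilinear.has_vector_derivative[OF bounded_bilinear_inner this this]
    show ?thesis
      by (simp add: has_real_derivative_iff_has_vector_derivative power2_norm_eq_inner inner_commute)
  qed
  from MVT2[of 0 1 "\<lambda>t. (norm (g (\<gamma> t)))\<^sup>2", OF _ this]
  obtain t where "0 < t" "t < 1"
    "(norm (g (\<gamma> 1)))\<^sup>2 - (norm (g (\<gamma> 0)))\<^sup>2 = 2 * (g' (\<gamma> t) (q - w) \<bullet> g (\<gamma> t))"
    by auto
  then show ?thesis
    using \<gamma>[of t] by (auto simp: \<gamma>_def)
qed

lemma
  assumes p: "p \<in> U" and X: "X \<longlonglongrightarrow> p"
  shows tendsto_g: "(\<lambda>n. g (X n)) \<longlonglongrightarrow> g p" and tendsto_g': "(\<lambda>n. g' (X n)) \<longlonglongrightarrow> g' p"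
  using isCont_tendsto_compose[OF _ X] cont_g cont_g' U p continuous_on_eq_continuous_at by blast+

lemma radial_projection:
  fixes w :: "nat \<Rightarrow> complex ^ 'm"
  assumes p: "norm p = 1" and w: "w \<longlonglongrightarrow> p"
  shows "(\<lambda>n. norm (w n)) \<longlonglongrightarrow> 1" "(\<lambda>n. w n /\<^sub>R norm (w n)) \<longlonglongrightarrow> p"
    "\<forall>\<^sub>F n in sequentially. w n \<noteq> 0"
proof -
  show nw: "(\<lambda>n. norm (w n)) \<longlonglongrightarrow> 1"
    using tendsto_norm[OF w] p by simp
  have "(\<lambda>n. w n /\<^sub>R norm (w n)) \<longlonglongrightarrow> p /\<^sub>R 1"
    by (intro tendsto_intros nw w) simp
  then show "(\<lambda>n. w n /\<^sub>R norm (w n)) \<longlonglongrightarrow> p" by simp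
  show "\<forall>\<^sub>F n in sequentially. w n \<noteq> 0"
    using order_tendstoD(1)[OF nw, of 0] by simp
qed

text \<open>The mean value theorem on the radial segment from \<open>w n\<close> to the sphere, where \<open>\<bar>g\<bar>\<^sup>2 = 1\<close>. The
  sequence may approach \<open>p\<close> in any way, also tangentially, since the foot point moves along with it.\<close>

lemma tendsto_defect_ratio:
  assumes p: "p \<in> U" "norm p = 1" and w: "w \<longlonglongrightarrow> p" "\<And>n. norm (w n) < 1"
  shows "(\<lambda>n. (1 - (norm (f (w n)))\<^sup>2) / (1 - (norm (w n))\<^sup>2)) \<longlonglongrightarrow> lam p"
proof -
  obtain \<epsilon> where \<epsilon>: "0 < \<epsilon>" "ball p \<epsilon> \<subseteq> U"
    using U p(1) open_contains_ball by blast
  define q where "q = (\<lambda>n. w n /\<^sub>R norm (w n))"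
  note proj = radial_projection[OF p(2) w(1)]
  note q = proj(2)[folded q_def]
  have ev: "\<forall>\<^sub>F n in sequentially. w n \<in> ball p \<epsilon> \<and> q n \<in> ball p \<epsilon> \<and> w n \<noteq> 0"
    using topological_tendstoD[OF w(1), of "ball p \<epsilon>"] topological_tendstoD[OF q, of "ball p \<epsilon>"]
      proj(3) \<epsilon>(1) by (simp add: eventually_conj_iff)
  have "\<exists>\<xi>\<in>closed_segment (w n) (q n).
      (1 - (norm (f (w n)))\<^sup>2) / (1 - (norm (w n))\<^sup>2) = 2 / (1 + norm (w n)) * (g' \<xi> (q n) \<bullet> g \<xi>)"
    if n: "w n \<in> ball p \<epsilon> \<and> q n \<in> ball p \<epsilon> \<and> w n \<noteq> 0" for n
  proof -
    have "closed_segment (w n) (q n) \<subseteq> U"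
      using n \<epsilon>(2) closed_segment_subset[of "w n" "ball p \<epsilon>" "q n"] by auto
    from norm_sq_mean_value[OF this] obtain \<xi> where \<xi>: "\<xi> \<in> closed_segment (w n) (q n)"
      "(norm (g (q n)))\<^sup>2 - (norm (g (w n)))\<^sup>2 = 2 * (g' \<xi> (q n - w n) \<bullet> g \<xi>)" by blast
    have qn: "norm (q n) = 1" and "w n = norm (w n) *\<^sub>R q n"
      using n by (simp_all add: q_def)
    then have "q n - w n = (1 - norm (w n)) *\<^sub>R q n"
      by (metis scaleR_left_diff_distrib scaleR_one)
    moreover have "norm (g (q n)) = 1" "g (w n) = f (w n)"
      using n qn w(2) \<epsilon>(2) sphere eq by auto
    ultimately have "1 - (norm (f (w n)))\<^sup>2 = 2 * ((1 - norm (w n)) * (g' \<xi> (q n) \<bullet> g \<xi>))"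
      using \<xi>(2) by (simp add: blinfun.scaleR_right)
    moreover have "1 - (norm (w n))\<^sup>2 = (1 - norm (w n)) * (1 + norm (w n))"
      by (simp add: power2_eq_square algebra_simps)
    moreover have "1 - norm (w n) \<noteq> 0"
      using w(2)[of n] by simp
    ultimately show ?thesis
      using \<xi>(1) by (intro bexI[of _ \<xi>]) simp_all
  qed
  then obtain \<xi> where \<xi>: "\<And>n. w n \<in> ball p \<epsilon> \<and> q n \<in> ball p \<epsilon> \<and> w n \<noteq> 0 \<Longrightarrow>
      \<xi> n \<in> closed_segment (w n) (q n) \<and> (1 - (norm (f (w n)))\<^sup>2) / (1 - (norm (w n))\<^sup>2)
        = 2 / (1 + norm (w n)) * (g' (\<xi> n) (q n) \<bullet> g (\<xi> n))"
    by metis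
  have "(\<lambda>n. \<xi> n - w n) \<longlonglongrightarrow> 0"
  proof (rule Lim_null_comparison)
    show "\<forall>\<^sub>F n in sequentially. norm (\<xi> n - w n) \<le> norm (q n - w n)"
      using ev by eventually_elim (use \<xi> segment_bound1 in blast)
    show "(\<lambda>n. norm (q n - w n)) \<longlonglongrightarrow> 0"
      using tendsto_norm[OF tendsto_diff[OF q w(1)]] by simp
  qed
  from tendsto_add[OF this w(1)] have \<xi>p: "\<xi> \<longlonglongrightarrow> p" by simp
  have "(\<lambda>n. 2 / (1 + norm (w n)) * (g' (\<xi> n) (q n) \<bullet> g (\<xi> n))) \<longlonglongrightarrow> 2 / (1 + 1) * (g' p p \<bullet> g p)"
    by (intro tendsto_intros proj tendsto_g tendsto_g' \<xi>p p q
        bounded_bilinear.tendsto[OF bounded_bilinear_blinfun_apply]) simp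
  then have "(\<lambda>n. 2 / (1 + norm (w n)) * (g' (\<xi> n) (q n) \<bullet> g (\<xi> n))) \<longlonglongrightarrow> lam p"
    by (simp add: lam_def)
  then show ?thesis
    by (rule Lim_transform_eventually) (use ev \<xi> in \<open>auto elim!: eventually_mono\<close>)
qed

text \<open>The defect ratio is bounded below by the boundary point lemma.\<close>

lemma lam_pos:
  assumes p: "p \<in> U" "norm p = 1"
  shows "0 < lam p"
proof -
  \<comment> \<open>Radial approach; the shift by two only keeps the factor positive.\<close>
  define w where "w = (\<lambda>n. (1 - 1 / real (n + 2)) *\<^sub>R p)"
  have "(\<lambda>n. 1 / real (n + 2)) \<longlonglongrightarrow> 0"
    using LIMSEQ_ignore_initial_segment[OF lim_1_over_n, of 2] by simp
  then have "w \<longlonglongrightarrow> (1 - 0) *\<^sub>R p"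
    unfolding w_def by (intro tendsto_intros)
  then have w: "w \<longlonglongrightarrow> p" by simp
  have w1: "norm (w n) < 1" for n
    using p(2) by (simp add: w_def)
  have f0: "norm (f 0) < 1"
    using image_subset_iff[THEN iffD1, OF maps] by simp
  have "(1 - norm (f 0))\<^sup>2 \<le> lam p"
  proof (rule LIMSEQ_le_const[OF tendsto_defect_ratio[OF p w w1]], intro exI allI impI)
    fix n
    show "(1 - norm (f 0))\<^sup>2 \<le> (1 - (norm (f (w n)))\<^sup>2) / (1 - (norm (w n))\<^sup>2)"
      using Hopf_ball[OF hol maps w1[of n]] one_minus_norm_sq_pos[OF w1[of n]]
      by (simp add: pos_le_divide_eq)
  qed
  then show ?thesis
    using f0 by (smt (verit) zero_less_power)
qed

text \<open>At the foot point \<open>q n = w n / \<bar>w n\<bar>\<close> the Hermitian product is known exactly. Replacing \<open>w n\<close> by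
  \<open>q n\<close> costs at most a constant times \<open>(1 - \<bar>w n\<bar>) \<bar>v n\<bar>\<close>, as \<open>g\<close> and \<open>g'\<close> are Lipschitz; divided by
  \<open>1 - \<bar>w n\<bar>\<^sup>2\<close> this still tends to \<open>0\<close> with \<open>v n\<close>.\<close>

lemma tendsto_normal_component:
  assumes p: "p \<in> U" "norm p = 1" and w: "w \<longlonglongrightarrow> p" "\<And>n. norm (w n) < 1"
    and v: "v \<longlonglongrightarrow> 0" and y: "(\<lambda>n. herm (v n) (w n) / of_real (1 - (norm (w n))\<^sup>2)) \<longlonglongrightarrow> y"
  shows "(\<lambda>n. herm (g' (w n) (v n)) (g (w n)) / of_real (1 - (norm (w n))\<^sup>2)) \<longlonglongrightarrow> of_real (lam p) * y"
proof -
  obtain \<epsilon>1 C1 where 1: "0 < \<epsilon>1" "ball p \<epsilon>1 \<subseteq> U" "\<And>x. x \<in> ball p \<epsilon>1 \<Longrightarrow> norm (g' x) \<le> C1"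
    "\<And>x y. x \<in> ball p \<epsilon>1 \<Longrightarrow> y \<in> ball p \<epsilon>1 \<Longrightarrow> norm (g x - g y) \<le> C1 * norm (x - y)"
    by (rule C1_locally_Lipschitz[OF U g' cont_g' p(1)]) blast+
  obtain \<epsilon>2 C2 where 2: "0 < \<epsilon>2" "ball p \<epsilon>2 \<subseteq> U" "\<And>x. x \<in> ball p \<epsilon>2 \<Longrightarrow> norm (g'' x) \<le> C2"
    "\<And>x y. x \<in> ball p \<epsilon>2 \<Longrightarrow> y \<in> ball p \<epsilon>2 \<Longrightarrow> norm (g' x - g' y) \<le> C2 * norm (x - y)"
    by (rule C1_locally_Lipschitz[OF U g'' cont_g'' p(1)]) blast+
  define \<epsilon> where "\<epsilon> = min \<epsilon>1 \<epsilon>2"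
  define q where "q = (\<lambda>n. w n /\<^sub>R norm (w n))"
  define r where "r = (\<lambda>n. 1 - (norm (w n))\<^sup>2)"
  note proj = radial_projection[OF p(2) w(1)]
  note q = proj(2)[folded q_def]
  have r_eq: "1 - (norm (w n))\<^sup>2 = r n" for n
    by (simp add: r_def)
  have r: "0 < r n" for n
    using one_minus_norm_sq_pos[OF w(2)] by (simp add: r_def)
  have ev: "\<forall>\<^sub>F n in sequentially. w n \<in> ball p \<epsilon> \<and> q n \<in> ball p \<epsilon> \<and> w n \<noteq> 0"
    using topological_tendstoD[OF w(1), of "ball p \<epsilon>"] topological_tendstoD[OF q, of "ball p \<epsilon>"]
      proj(3) 1(1) 2(1) by (simp add: eventually_conj_iff \<epsilon>_def)
  \<comment> \<open>The error made by moving from \<open>w n\<close> to its foot point \<open>q n\<close>.\<close>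
  define E where "E = (\<lambda>n. herm (g' (w n) (v n)) (g (w n)) - herm (g' (q n) (v n)) (g (q n)))"
  have E: "(\<lambda>n. E n / of_real (r n)) \<longlonglongrightarrow> 0"
  proof (rule Lim_null_comparison)
    show "(\<lambda>n. (C2 + C1 * C1) * norm (v n)) \<longlonglongrightarrow> 0"
      using tendsto_mult_right_zero[OF tendsto_norm_zero[OF v]] .
    show "\<forall>\<^sub>F n in sequentially. norm (E n / of_real (r n)) \<le> (C2 + C1 * C1) * norm (v n)"
      using ev
    proof eventually_elim
      case (elim n)
      have qn: "norm (q n) = 1" and wq: "w n = norm (w n) *\<^sub>R q n"
        using elim by (simp_all add: q_def)
      have "norm (w n - q n) = 1 - norm (w n)"
      proof -
        have "w n - q n = - ((1 - norm (w n)) *\<^sub>R q n)"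
          using wq by (metis minus_diff_eq scaleR_left_diff_distrib scaleR_one)
        then show ?thesis
          using qn w(2)[of n] by simp
      qed
      also have "\<dots> \<le> r n"
        using w(2)[of n] by (simp add: r_def power2_eq_square mult_left_le)
      finally have s: "norm (w n - q n) \<le> r n" .
      have inU: "w n \<in> U" "q n \<in> U"
        using elim 1(2) by (auto simp: \<epsilon>_def)
      have C1: "0 \<le> C1" and C2: "0 \<le> C2"
      proof -
        show "0 \<le> C1"
          using 1(3)[of p] 1(1) norm_ge_zero by (metis centre_in_ball order_trans)
        show "0 \<le> C2"
          using 2(3)[of p] 2(1) norm_ge_zero by (metis centre_in_ball order_trans)
      qed
      have gw: "norm (g (w n)) \<le> 1"
        using image_subset_iff[THEN iffD1, OF maps] w(2)[of n] eq[OF inU(1)] by (simp add: less_imp_le)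
      have "E n = herm ((g' (w n) - g' (q n)) (v n)) (g (w n)) + herm (g' (q n) (v n)) (g (w n) - g (q n))"
        by (simp add: E_def herm_simps blinfun.diff_left)
      also have "cmod \<dots> \<le> norm ((g' (w n) - g' (q n)) (v n)) * norm (g (w n))
          + norm (g' (q n) (v n)) * norm (g (w n) - g (q n))"
        by (intro order_trans[OF norm_triangle_ineq] add_mono Cauchy_Schwarz_herm)
      also have "\<dots> \<le> (C2 * r n * norm (v n)) * 1 + (C1 * norm (v n)) * (C1 * r n)"
      proof (intro add_mono mult_mono gw)
        have "norm (g' (w n) - g' (q n)) \<le> C2 * r n"
          using 2(4)[of "w n" "q n"] elim s C2
          by (auto simp: \<epsilon>_def intro: order_trans mult_left_mono)
        then show "norm ((g' (w n) - g' (q n)) (v n)) \<le> C2 * r n * norm (v n)"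
          by (intro order_trans[OF norm_blinfun mult_right_mono]) simp_all
        show "norm (g' (q n) (v n)) \<le> C1 * norm (v n)"
          using 1(3)[of "q n"] elim
          by (intro order_trans[OF norm_blinfun mult_right_mono]) (simp_all add: \<epsilon>_def)
        show "norm (g (w n) - g (q n)) \<le> C1 * r n"
          using 1(4)[of "w n" "q n"] elim s C1
          by (auto simp: \<epsilon>_def intro: order_trans mult_left_mono)
      qed (use C1 C2 r[of n] in auto)
      also have "\<dots> = (C2 + C1 * C1) * norm (v n) * r n"
        by (simp add: algebra_simps)
      finally show ?case
        using r[of n] by (simp add: norm_divide pos_divide_le_eq)
    qed
  qed
  have lamq: "(\<lambda>n. lam (q n)) \<longlonglongrightarrow> lam p"
    unfolding lam_def
    by (intro tendsto_intros tendsto_g tendsto_g' p q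
        bounded_bilinear.tendsto[OF bounded_bilinear_blinfun_apply])
  have "(\<lambda>n. of_real (lam (q n)) * (herm (v n) (w n) / of_real (r n)) / of_real (norm (w n)) + E n / of_real (r n))
      \<longlonglongrightarrow> of_real (lam p) * y / of_real 1 + 0"
    by (intro tendsto_intros lamq E proj y[unfolded r_eq]) simp
  then have "(\<lambda>n. of_real (lam (q n)) * (herm (v n) (w n) / of_real (r n)) / of_real (norm (w n)) + E n / of_real (r n))
      \<longlonglongrightarrow> of_real (lam p) * y" by simp
  then show ?thesis
  proof (rule Lim_transform_eventually)
    show "\<forall>\<^sub>F n in sequentially. of_real (lam (q n)) * (herm (v n) (w n) / of_real (r n)) / of_real (norm (w n))
        + E n / of_real (r n) = herm (g' (w n) (v n)) (g (w n)) / of_real (1 - (norm (w n))\<^sup>2)"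
      using ev
    proof eventually_elim
      case (elim n)
      have "q n \<in> U" "norm (q n) = 1"
        using elim 1(2) by (auto simp: \<epsilon>_def q_def)
      then have "herm (g' (q n) (v n)) (g (q n)) = of_real (lam (q n)) * herm (v n) (q n)"
        by (rule herm_boundary_derivative)
      also have "herm (v n) (q n) = herm (v n) (w n) / of_real (norm (w n))"
        by (simp add: q_def herm_scaleR_right scaleR_conv_of_real[where 'a=complex] divide_inverse mult.commute)
      finally have "herm (g' (w n) (v n)) (g (w n)) =
          of_real (lam (q n)) * herm (v n) (w n) / of_real (norm (w n)) + E n"
        by (simp add: E_def)
      then show ?case
        unfolding r_eq by (simp add: add_divide_distrib)
    qed
  qed
qed

text \<open>The Bergman metric splits into a part of order \<open>1 / r\<close> with limit \<open>\<bar>x\<bar>\<^sup>2\<close> and a normal part of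
  order \<open>1 / r\<^sup>2\<close> with limit \<open>\<bar>y\<bar>\<^sup>2\<close>, where \<open>r = 1 - \<bar>w n\<bar>\<^sup>2\<close>. The limit \<open>x\<close> of the rescaled vectors is complex
  tangent at \<open>p\<close>. Under \<open>f\<close> the factor \<open>r\<close> and the normal component are multiplied by \<open>lam p\<close>, the
  tangential component by its square root, so that all factors cancel.\<close>

lemma bergman_asymptotically_isometric:
  assumes p: "p \<in> U" "norm p = 1" and w: "w \<longlonglongrightarrow> p" "\<And>n. norm (w n) < 1"
    and x: "(\<lambda>n. v n /\<^sub>R sqrt (1 - (norm (w n))\<^sup>2)) \<longlonglongrightarrow> x"
    and y: "(\<lambda>n. herm (v n) (w n) / of_real (1 - (norm (w n))\<^sup>2)) \<longlonglongrightarrow> y"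
  shows "(\<lambda>n. bergman (w n) (v n)) \<longlonglongrightarrow> (norm x)\<^sup>2 + (cmod y)\<^sup>2"
    and "(\<lambda>n. bergman (f (w n)) (g' (w n) (v n))) \<longlonglongrightarrow> (norm x)\<^sup>2 + (cmod y)\<^sup>2"
proof -
  define r where "r = (\<lambda>n. 1 - (norm (w n))\<^sup>2)"
  define \<rho> where "\<rho> = (\<lambda>n. (1 - (norm (f (w n)))\<^sup>2) / r n)"
  have r_eq: "1 - (norm (w n))\<^sup>2 = r n" for n
    by (simp add: r_def)
  note x = x[unfolded r_eq] and y' = y[unfolded r_eq]
  have r: "0 < r n" for n
    using one_minus_norm_sq_pos[OF w(2)] by (simp add: r_def)
  have "bergman (w n) (v n) = (norm (v n /\<^sub>R sqrt (r n)))\<^sup>2 + (cmod (herm (v n) (w n) / of_real (r n)))\<^sup>2" for n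
    using r[of n] unfolding bergman_def r_eq
    by (simp add: power_mult_distrib power_divide norm_divide norm_mult norm_inverse
        power_inverse divide_inverse mult.commute)
  then show "(\<lambda>n. bergman (w n) (v n)) \<longlonglongrightarrow> (norm x)\<^sup>2 + (cmod y)\<^sup>2"
    using tendsto_add[OF tendsto_power[OF tendsto_norm[OF x]] tendsto_power[OF tendsto_norm[OF y']]]
    by simp
  have r0: "r \<longlonglongrightarrow> 1 - 1\<^sup>2"
    unfolding r_def by (intro tendsto_intros radial_projection[OF p(2) w(1)])
  have sr0: "(\<lambda>n. sqrt (r n)) \<longlonglongrightarrow> 0"
    using tendsto_real_sqrt[OF r0] by simp
  have "(\<lambda>n. sqrt (r n) *\<^sub>R (v n /\<^sub>R sqrt (r n))) \<longlonglongrightarrow> 0 *\<^sub>R x"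
    by (rule tendsto_scaleR[OF sr0 x])
  moreover have "sqrt (r n) *\<^sub>R (v n /\<^sub>R sqrt (r n)) = v n" for n
    using r[of n] by simp
  ultimately have v0: "v \<longlonglongrightarrow> 0" by simp
  have "herm x p = 0"
  proof (rule LIMSEQ_unique)
    show "(\<lambda>n. herm (v n /\<^sub>R sqrt (r n)) (w n)) \<longlonglongrightarrow> herm x p"
      by (rule tendsto_herm[OF x w(1)])
    have "(\<lambda>n. sqrt (r n) *\<^sub>R (herm (v n) (w n) / of_real (r n))) \<longlonglongrightarrow> 0 *\<^sub>R y"
      by (rule tendsto_scaleR[OF sr0 y'])
    moreover have "sqrt (r n) *\<^sub>R (herm (v n) (w n) / of_real (r n)) = herm (v n /\<^sub>R sqrt (r n)) (w n)" for n
    proof -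
      have "sqrt (r n) / r n = 1 / sqrt (r n)"
        using r[of n] by (metis less_imp_le real_div_sqrt divide_divide_eq_right mult_1 sqrt_divide_self_eq inverse_eq_divide)
      then show ?thesis
        unfolding herm_scaleR_left
        by (simp add: scaleR_conv_of_real[where 'a=complex] divide_inverse mult.commute mult.left_commute flip: of_real_inverse of_real_mult)
    qed
    ultimately show "(\<lambda>n. herm (v n /\<^sub>R sqrt (r n)) (w n)) \<longlonglongrightarrow> 0" by simp
  qed
  then have tangential: "(norm (g' p x))\<^sup>2 = lam p * (norm x)\<^sup>2"
    by (rule norm_boundary_derivative[OF p])
  have lam: "0 < lam p"
    using lam_pos[OF p] .
  have \<rho>: "\<rho> \<longlonglongrightarrow> lam p"
    using tendsto_defect_ratio[OF p w] by (simp add: \<rho>_def r_def)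
  have "(\<lambda>n. (norm (g' (w n) (v n /\<^sub>R sqrt (r n))))\<^sup>2 / \<rho> n
      + (cmod (herm (g' (w n) (v n)) (g (w n)) / of_real (r n)))\<^sup>2 / (\<rho> n)\<^sup>2)
      \<longlonglongrightarrow> (norm (g' p x))\<^sup>2 / lam p + (cmod (of_real (lam p) * y))\<^sup>2 / (lam p)\<^sup>2"
    using lam tendsto_normal_component[OF p w v0 y]
    by (intro tendsto_add tendsto_divide tendsto_power tendsto_norm \<rho>
        bounded_bilinear.tendsto[OF bounded_bilinear_blinfun_apply tendsto_g'[OF p(1) w(1)] x])
       (simp_all add: r_def)
  moreover have "(norm (g' p x))\<^sup>2 / lam p + (cmod (of_real (lam p) * y))\<^sup>2 / (lam p)\<^sup>2
      = (norm x)\<^sup>2 + (cmod y)\<^sup>2"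
    using lam by (simp add: tangential norm_mult power_mult_distrib)
  moreover have "\<forall>\<^sub>F n in sequentially. (norm (g' (w n) (v n /\<^sub>R sqrt (r n))))\<^sup>2 / \<rho> n
      + (cmod (herm (g' (w n) (v n)) (g (w n)) / of_real (r n)))\<^sup>2 / (\<rho> n)\<^sup>2
      = bergman (f (w n)) (g' (w n) (v n))"
    using topological_tendstoD[OF w(1) U p(1)]
  proof eventually_elim
    case (elim n)
    have "g (w n) = f (w n)"
      using eq elim w(2) by blast
    moreover have "(norm (g' (w n) (v n /\<^sub>R sqrt (r n))))\<^sup>2 = (norm (g' (w n) (v n)))\<^sup>2 / r n"
      using r[of n] by (simp add: blinfun.scaleR_right power_mult_distrib power_inverse divide_inverse mult.commute)
    ultimately show ?case
      using r[of n] unfolding bergman_def \<rho>_def r_eq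
      by (simp add: norm_divide power_divide)
  qed
  ultimately show "(\<lambda>n. bergman (f (w n)) (g' (w n) (v n))) \<longlonglongrightarrow> (norm x)\<^sup>2 + (cmod y)\<^sup>2"
    using Lim_transform_eventually by fastforce
qed

end

section \<open>Rigidity\<close>

lemma isometry_herm:
  assumes "linear D" "complex_linear D" "\<And>v. norm (D v) = norm v"
  shows "herm (D x) (D y) = herm x y"
proof -
  have inner: "D x \<bullet> D y = x \<bullet> y" for x y
    unfolding dot_norm linear_add[OF assms(1), symmetric] assms(3) ..
  have "D (\<i> *s x) = \<i> *s D x"
    using assms(2) by (simp add: complex_linear_def)
  then show ?thesis
    unfolding herm_eq_inner using inner[of x y] inner[of "\<i> *s x" y] by simp
qed

lemma herm_sum_left: "herm (\<Sum>i\<in>I. h i) y = (\<Sum>i\<in>I. herm (h i) y)"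
  by (rule linear_sum[OF bounded_linear.linear[OF bounded_linear_herm_left]])

lemma herm_sum_right: "herm y (\<Sum>i\<in>I. h i) = (\<Sum>i\<in>I. herm y (h i))"
  unfolding cnj_herm[of _ y, symmetric] herm_sum_left cnj_sum ..

lemma herm_axis: "herm (axis i 1) (axis j 1) = (if i = j then 1 else 0)"
  unfolding herm_def axis_def
  by (simp add: if_distrib[of cnj] if_distrib[of "(*) _"] cong: if_cong)

text \<open>The conditions \<open>\<langle>x, e j\<rangle> = 0\<close> for \<open>j \<in> S\<close> are the rows of a square matrix whose row \<open>k\<close> is
  zero. It is singular, so it has a nonzero kernel vector.\<close>

lemma orthogonal_unit_vector_ex:
  fixes e :: "'n \<Rightarrow> complex ^ 'n"
  assumes k: "k \<notin> S"
  obtains u where "herm u u = 1" "\<And>j. j \<in> S \<Longrightarrow> herm u (e j) = 0"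
proof -
  define A :: "complex ^ 'n ^ 'n" where "A = (\<chi> i. if i \<in> S then (\<chi> j. cnj (e i $ j)) else 0)"
  have "row k A = 0"
    using k by (simp add: row_def A_def vec_eq_iff)
  then have "det A = 0"
    by (rule det_zero_row)
  then have "\<not> invertible A"
    by (simp add: invertible_det_nz)
  then have "\<not> (\<exists>B. B ** A = mat 1)"
    unfolding invertible_def using matrix_left_right_inverse by blast
  then obtain x where x: "A *v x = 0" "x \<noteq> 0"
    unfolding matrix_left_invertible_ker by blast
  have ortho: "herm x (e j) = 0" if "j \<in> S" for j
  proof -
    have "herm x (e j) = (A *v x) $ j"
      using that by (simp add: herm_def matrix_vector_mult_def A_def mult.commute)
    then show ?thesis
      using x(1) by simp
  qed
  let ?u = "(1 / norm x) *\<^sub>R x"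
  have "norm ?u = 1"
    using x(2) by simp
  then have "herm ?u ?u = 1"
    by (simp only: herm_self) simp
  moreover have "herm ?u (e j) = 0" if "j \<in> S" for j
    using ortho[OF that] by (simp add: herm_scaleR_left)
  ultimately show ?thesis
    using that by blast
qed

text \<open>Induction on the number of missing vectors, with one orthogonal unit vector added at a time.\<close>

lemma orthonormal_extension:
  fixes e :: "'n \<Rightarrow> complex ^ 'n"
  assumes "\<And>i j. i \<in> S \<Longrightarrow> j \<in> S \<Longrightarrow> herm (e i) (e j) = (if i = j then 1 else 0)"
  shows "\<exists>e'. (\<forall>i\<in>S. e' i = e i) \<and> (\<forall>i j. herm (e' i) (e' j) = (if i = j then 1 else 0))"
  using assms
proof (induction "card (UNIV - S)" arbitrary: S e)
  case 0
  then have "S = UNIV" by auto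
  then show ?case
    using 0(2) by (intro exI[of _ e]) auto
next
  case (Suc n)
  then obtain k where k: "k \<notin> S"
    by (metis DiffE all_not_in_conv card.empty nat.distinct(1))
  obtain u where u: "herm u u = 1" "\<And>j. j \<in> S \<Longrightarrow> herm u (e j) = 0"
    using orthogonal_unit_vector_ex[OF k] by metis
  have u': "herm (e j) u = 0" if "j \<in> S" for j
    using u(2)[OF that] cnj_herm[of u "e j"] by simp
  have "UNIV - S = insert k (UNIV - insert k S)"
    using k by auto
  then have "n = card (UNIV - insert k S)"
    using Suc(2) by simp
  moreover have "herm ((e(k := u)) i) ((e(k := u)) j) = (if i = j then 1 else 0)"
    if "i \<in> insert k S" "j \<in> insert k S" for i j
    using that k Suc(3) u u' by auto
  ultimately obtain e' where "\<forall>i\<in>insert k S. e' i = (e(k := u)) i"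
    "\<forall>i j. herm (e' i) (e' j) = (if i = j then 1 else 0)"
    using Suc(1)[of "insert k S" "e(k := u)"] by blast
  then show ?case
    using k by (intro exI[of _ e']) auto
qed

lemma columns_mult: "(\<chi> i j. e j $ i) *v z = (\<Sum>j\<in>UNIV. z $ j *s (e j :: complex ^ 'n))"
  by (simp add: vec_eq_iff matrix_vector_mult_def mult.commute)

text \<open>The vectors \<open>D (axis i 1)\<close>, placed at the positions \<open>\<iota> i\<close>, are completed to an orthonormal
  basis; the required matrix is the inverse of the one with this basis as columns.\<close>

lemma unitary_completion:
  fixes D :: "complex ^ 'm \<Rightarrow> complex ^ 'n"
  assumes D: "linear D" "complex_linear D" "\<And>v. norm (D v) = norm v" and \<iota>: "inj \<iota>"
  obtains A :: "complex ^ 'n ^ 'n" where "isometric_matrix A" "\<And>z. A *v D z = pad_zero \<iota> z"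
proof -
  let ?e = "\<lambda>j. D (axis (inv \<iota> j) 1)"
  have "herm (?e i) (?e j) = (if i = j then 1 else 0)" if "i \<in> range \<iota>" "j \<in> range \<iota>" for i j
    using that \<iota> by (auto simp: isometry_herm[OF D] herm_axis inj_eq)
  then obtain e where e: "\<forall>i\<in>range \<iota>. e i = ?e i" "\<And>i j. herm (e i) (e j) = (if i = j then 1 else 0)"
    using orthonormal_extension[of "range \<iota>" ?e] by blast
  let ?V = "(\<chi> i j. e j $ i) :: complex ^ 'n ^ 'n"
  have "herm (?V *v z) (?V *v z) = herm z z" for z
    unfolding columns_mult herm_sum_left herm_sum_right herm_simps e(2)
    by (simp add: herm_def if_distrib[of "(*) _"] mult.commute cong: if_cong)
  then have "norm (?V *v z) = norm z" for z
    by (metis Re_herm norm_eq)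
  then have V: "isometric_matrix ?V"
    by (simp add: isometric_matrix_def)
  obtain A where A: "A ** ?V = mat 1" "isometric_matrix A"
    using isometric_matrix_inverse[OF V] by metis
  have "?V *v pad_zero \<iota> z = D z" for z
  proof -
    have "?V *v pad_zero \<iota> z = (\<Sum>j\<in>UNIV. pad_zero \<iota> z $ j *s e j)"
      by (rule columns_mult)
    also have "\<dots> = (\<Sum>j\<in>range \<iota>. z $ inv \<iota> j *s e j)"
      by (rule sum.mono_neutral_cong_right) (auto simp: pad_zero_def)
    also have "\<dots> = (\<Sum>i\<in>UNIV. z $ i *s D (axis i 1))"
      using \<iota> e(1) by (simp add: sum.reindex)
    also have "\<dots> = D (\<Sum>i\<in>UNIV. z $ i *s axis i 1)"
      using D(2) by (simp add: linear_sum[OF D(1)] complex_linear_def)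
    finally show ?thesis
      by (simp add: basis_expansion)
  qed
  then have "A *v D z = pad_zero \<iota> z" for z
    by (metis A(1) matrix_vector_mul_assoc matrix_vector_mul_lid)
  then show ?thesis
    using that A(2) by blast
qed

lemma card_le_if_isometry:
  fixes D :: "complex ^ 'm \<Rightarrow> complex ^ 'n"
  assumes D: "linear D" "\<And>v. norm (D v) = norm v"
  shows "CARD('m) \<le> CARD('n)"
proof -
  have "inj D"
    using D(2) by (intro linear_injective_0[OF D(1), THEN iffD2]) (metis norm_eq_zero)
  then have "dim (range D) = DIM(complex ^ 'm)"
    using dim_image_eq[OF D(1), of UNIV] by simp
  then have "DIM(complex ^ 'm) \<le> DIM(complex ^ 'n)"
    by (metis dim_subset_UNIV)
  then show ?thesis by simp
qed

text \<open>Composing with an involution brings \<open>f 0\<close> to the origin; the hypothesis becomes that the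
  derivative at \<open>0\<close> preserves the norm, and the equality case of the Schwarz lemma applies.\<close>

lemma linear_normal_form:
  assumes hol: "holomorphic_map_on f (ball 0 1)" and f: "f ` ball 0 1 \<subseteq> ball 0 1"
    and D: "(f has_derivative D) (at 0)" "complex_linear D"
    and isom: "\<And>v. bergman (f 0) (D v) = (norm v)\<^sup>2"
  obtains L where "linear L" "complex_linear L" "\<And>v. norm (L v) = norm v"
    "\<And>z. norm z < 1 \<Longrightarrow> mob (f 0) (f z) = L z"
proof -
  have nf: "norm (f z) < 1" if "norm z < 1" for z
    using image_subset_iff[THEN iffD1, OF f] that by simp
  then have f0: "norm (f 0) < 1" by simp
  obtain M where M: "(mob (f 0) has_derivative M) (at (f 0))" "complex_linear M"
    by (rule holomorphic_map_onE[OF holomorphic_mob[OF f0], of "f 0"]) (use f0 in auto)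
  define L where "L = (\<lambda>v. M (D v))"
  have L: "((\<lambda>z. mob (f 0) (f z)) has_derivative L) (at 0)"
    unfolding L_def by (rule has_derivative_compose[OF D(1) M(1)])
  have lin: "complex_linear L"
    using D M by (simp add: L_def complex_linear_def)
  have norm_L: "norm (L v) = norm v" for v
    using mob_bergman[OF f0 f0 M(1), of "D v"] f0 isom by (simp add: L_def)
  have "mob (f 0) (f z) = L z" if "norm z < 1" for z
  proof (rule Schwarz_ball_equality[OF _ _ _ L lin norm_L that])
    show "holomorphic_map_on (\<lambda>z. mob (f 0) (f z)) (ball 0 1)"
      by (rule holomorphic_map_on_compose[OF hol holomorphic_mob[OF f0]]) (use nf in simp)
    show "(\<lambda>z. mob (f 0) (f z)) ` ball 0 1 \<subseteq> ball 0 1"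
      using nf norm_mob_less[OF f0] by auto
    show "mob (f 0) (f 0) = 0"
      using f0 by simp
  qed
  then show ?thesis
    using that[of L] lin norm_L has_derivative_linear[OF L] by blast
qed

text \<open>The relation \<open>\<psi> n \<circ> f = f \<circ> \<phi> n\<close> and the invariance of the Bergman metrics transport the two
  sides, for every \<open>n\<close>, to the point \<open>\<phi> n 0\<close> and to the image of \<open>v\<close> under the
  derivative of \<open>\<phi> n\<close> at \<open>0\<close>. There they agree in the limit,
  while their values do not depend on \<open>n\<close>.\<close>

lemma (in boundary_extension) derivative_isometric_at_0:
  assumes p: "p \<in> U" "norm p = 1"
    and G: "\<And>n. (\<phi> n, \<psi> n) \<in> G_group f" and lim: "(\<lambda>n. \<phi> n 0) \<longlonglongrightarrow> p"
    and D: "(f has_derivative D) (at 0)"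
  shows "bergman (f 0) (D v) = (norm v)\<^sup>2"
proof -
  have \<phi>: "\<phi> n \<in> Aut (ball 0 1)" and \<psi>: "\<psi> n \<in> Aut (ball 0 1)"
    and comm: "norm z < 1 \<Longrightarrow> \<psi> n (f z) = f (\<phi> n z)" for n z
    using G[of n] by (auto simp: G_group_def)
  have f0: "norm (f 0) < 1"
    using image_subset_iff[THEN iffD1, OF maps] by simp
  define w where "w = (\<lambda>n. \<phi> n 0)"
  have w1: "norm (w n) < 1" for n
    using AutD(2)[OF \<phi>[of n]] by (force simp: w_def)
  have "\<exists>E. (\<phi> n has_derivative E) (at 0)" for n
    using holomorphic_map_onE[OF AutD(1)[OF \<phi>[of n]], of 0] by (metis centre_in_ball zero_less_one)
  then obtain E where E: "\<And>n. (\<phi> n has_derivative E n) (at 0)"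
    by metis
  define u where "u = (\<lambda>n. E n v)"
  have bw: "bergman (w n) (u n) = (norm v)\<^sup>2" for n
    using Aut_bergman[OF \<phi> _ E, of n v] by (simp add: w_def u_def)
  have bf: "bergman (f (w n)) (g' (w n) (u n)) = bergman (f 0) (D v)" if "w n \<in> U" for n
  proof -
    obtain P where P: "(\<psi> n has_derivative P) (at (f 0))"
      using holomorphic_map_onE[OF AutD(1)[OF \<psi>[of n]], of "f 0"] f0 by auto
    have 1: "((\<lambda>z. \<psi> n (f z)) has_derivative (\<lambda>v. P (D v))) (at 0)"
      by (rule has_derivative_compose[OF D P])
    have "((\<lambda>z. f (\<phi> n z)) has_derivative (\<lambda>v. g' (w n) (E n v))) (at 0)"
      by (rule has_derivative_compose[OF E]) (use f_deriv[OF that w1] in \<open>simp add: w_def\<close>)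
    then have "((\<lambda>z. \<psi> n (f z)) has_derivative (\<lambda>v. g' (w n) (E n v))) (at 0)"
      by (rule has_derivative_transform_within_open[where s="ball 0 1"]) (use comm in auto)
    from has_derivative_unique[OF 1 this] have "P (D v) = g' (w n) (u n)"
      unfolding u_def by metis
    then show ?thesis
      using Aut_bergman[OF \<psi> f0 P, of "D v"] comm[of 0 n] by (simp add: w_def)
  qed
  define r where "r = (\<lambda>n. 1 - (norm (w n))\<^sup>2)"
  have r: "0 < r n" for n
    using one_minus_norm_sq_pos[OF w1] by (simp add: r_def)
  define x where "x = (\<lambda>n. u n /\<^sub>R sqrt (r n))"
  define y where "y = (\<lambda>n. herm (u n) (w n) / of_real (r n))"
  have xy: "(norm (x n))\<^sup>2 + (cmod (y n))\<^sup>2 = (norm v)\<^sup>2" for n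
  proof -
    have "1 - (norm (w n))\<^sup>2 = r n"
      by (simp add: r_def)
    then show ?thesis
      using r[of n] bw[of n] unfolding bergman_def x_def y_def
      by (simp add: power_mult_distrib power_divide norm_divide power_inverse divide_inverse
          norm_mult norm_inverse mult.commute)
  qed
  have xyK: "(x n, y n) \<in> cball 0 (norm v) \<times> cball 0 (norm v)" for n
  proof -
    have "(norm (x n))\<^sup>2 \<le> (norm v)\<^sup>2" "(cmod (y n))\<^sup>2 \<le> (norm v)\<^sup>2"
      using xy[of n] by (smt (verit) zero_le_power2)+
    then have "norm (x n) \<le> norm v" "cmod (y n) \<le> norm v"
      using power2_le_imp_le norm_ge_zero by blast+
    then show ?thesis by simp
  qed
  \<comment> \<open>The rescaled components are bounded, and a subsequence of them converges.\<close>
  have "seq_compact (cball (0 :: complex ^ 'm) (norm v) \<times> cball (0 :: complex) (norm v))"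
    by (intro compact_imp_seq_compact compact_Times compact_cball)
  then obtain l s where s: "strict_mono (s :: nat \<Rightarrow> nat)" "((\<lambda>n. (x n, y n)) \<circ> s) \<longlonglongrightarrow> l"
    by (rule seq_compactE[where f="\<lambda>n. (x n, y n)"]) (use xyK in auto)
  have xs: "(\<lambda>n. x (s n)) \<longlonglongrightarrow> fst l" and ys: "(\<lambda>n. y (s n)) \<longlonglongrightarrow> snd l"
    using tendsto_fst[OF s(2)] tendsto_snd[OF s(2)] by (simp_all add: comp_def)
  have ws: "(\<lambda>n. w (s n)) \<longlonglongrightarrow> p"
    using LIMSEQ_subseq_LIMSEQ[OF lim s(1)] by (simp add: comp_def w_def)
  note lims = bergman_asymptotically_isometric[OF p ws w1
      xs[unfolded x_def r_def] ys[unfolded y_def r_def]]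
  have "(norm v)\<^sup>2 = (norm (fst l))\<^sup>2 + (cmod (snd l))\<^sup>2"
    using lims(1) by (simp add: bw LIMSEQ_const_iff)
  moreover have "(\<lambda>n. bergman (f 0) (D v)) \<longlonglongrightarrow> (norm (fst l))\<^sup>2 + (cmod (snd l))\<^sup>2"
    by (rule Lim_transform_eventually[OF lims(2)])
       (use topological_tendstoD[OF ws U p(1)] bf in \<open>auto elim!: eventually_mono\<close>)
  then have "bergman (f 0) (D v) = (norm (fst l))\<^sup>2 + (cmod (snd l))\<^sup>2"
    by (simp add: LIMSEQ_const_iff)
  ultimately show ?thesis by simp
qed

text \<open>A value \<open>F q\<close> inside the ball would keep \<open>f\<close> of the radius towards \<open>q\<close> in a compact subset of the
  target, whose preimage is compact and so cannot accumulate at the sphere.\<close>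

lemma proper_map_sphere_to_sphere:
  fixes f F :: "complex ^ 'm \<Rightarrow> complex ^ 'n"
  assumes proper: "proper_between (ball 0 1) (ball 0 1) f"
    and F: "F \<in> cball 0 1 \<rightarrow> cball 0 1" "\<And>z. norm z < 1 \<Longrightarrow> F z = f z"
    and cont: "(g \<longlongrightarrow> F q) (at q)" "\<forall>\<^sub>F z in at q. norm z < 1 \<longrightarrow> g z = F z" and q: "norm q = 1"
  shows "norm (F q) = 1"
proof (rule antisym)
  show "norm (F q) \<le> 1"
    using F(1) q by (auto simp: Pi_iff)
  show "1 \<le> norm (F q)"
  proof (rule ccontr)
    assume less: "\<not> 1 \<le> norm (F q)"
    define R where "R = (1 + norm (F q)) / 2"
    have R: "norm (F q) < R" "R < 1"
      using less by (simp_all add: R_def)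
    define K where "K = {z \<in> ball 0 1. f z \<in> cball 0 R}"
    have "cball 0 R \<subseteq> ball (0 :: complex ^ 'n) 1"
      using R by auto
    from proper[unfolded proper_between_def, THEN conjunct2, rule_format, OF this compact_cball]
    have "compact K"
      by (simp only: K_def)
    have t: "filterlim (\<lambda>t. t *\<^sub>R q) (at q) (at_left 1)"
    proof (rule filterlim_atI)
      show "((\<lambda>t. t *\<^sub>R q) \<longlongrightarrow> q) (at_left 1)"
        using tendsto_scaleR[OF tendsto_ident_at tendsto_const[of q], of 1] by simp
      show "\<forall>\<^sub>F t in at_left 1. t *\<^sub>R q \<noteq> q"
      proof (rule eventually_at_filter[THEN iffD2], intro always_eventually allI impI)
        fix t :: real assume "t \<noteq> 1"
        then have "(t - 1) *\<^sub>R q \<noteq> 0"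
          using q by force
        then show "t *\<^sub>R q \<noteq> q"
          by (simp add: scaleR_left_diff_distrib)
      qed
    qed
    have "\<forall>\<^sub>F z in at q. norm (g z) < R"
      using order_tendstoD(2)[OF tendsto_norm[OF cont(1)] R(1)] .
    with cont(2) have "\<forall>\<^sub>F z in at q. norm z < 1 \<longrightarrow> z \<in> K"
      by eventually_elim (use F(2) in \<open>auto simp: K_def\<close>)
    then have "\<forall>\<^sub>F t in at_left 1. norm (t *\<^sub>R q) < 1 \<longrightarrow> t *\<^sub>R q \<in> K"
      using t unfolding filterlim_iff by blast
    then have "\<forall>\<^sub>F t in at_left 1. t *\<^sub>R q \<in> K"
      using eventually_at_left_real[of 0 1, simplified]
      by eventually_elim (use q in simp)
    then have "q \<in> K"
      using \<open>compact K\<close> t by (intro Lim_in_closed_set[of K "\<lambda>t. t *\<^sub>R q" "at_left 1"])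
        (auto simp: compact_imp_closed filterlim_at)
    then show False
      using q by (simp add: K_def)
  qed
qed

theorem theorem1p2:
  fixes f :: "complex ^ 'm \<Rightarrow> complex ^ 'n"
  assumes "holomorphic_map_on f (ball 0 1)"
    and "proper_between (ball 0 1) (ball 0 1) f"
    and "\<exists>F. F \<in> cball 0 1 \<rightarrow> cball 0 1 \<and> C2_smooth_on F (cball 0 1) \<and> (\<forall>z\<in>ball 0 1. F z = f z)"
    and "\<not> compact_space (G_topology f)"
  shows "CARD('m) \<le> CARD('n) \<and>
    (\<forall>\<iota> :: 'm \<Rightarrow> 'n. inj \<iota> \<longrightarrow>
      (\<exists>\<phi>\<^sub>1 \<in> Aut (ball 0 1). \<exists>\<phi>\<^sub>2 \<in> Aut (ball 0 1).
        \<forall>z\<in>ball 0 1. \<phi>\<^sub>2 (f (\<phi>\<^sub>1 z)) = pad_zero \<iota> z))"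
proof -
  have maps: "f ` ball 0 1 \<subseteq> ball 0 1"
    using assms(2) by (auto simp: proper_between_def Pi_iff)
  obtain F where F: "F \<in> cball 0 1 \<rightarrow> cball 0 1" "C2_smooth_on F (cball 0 1)"
    "\<And>z. norm z < 1 \<Longrightarrow> F z = f z"
    using assms(3) by auto
  have "\<exists>\<phi> \<psi>. (\<phi>, \<psi>) \<in> G_group f \<and> 1 - 1 / real (Suc n) < norm (\<phi> 0)" for n
    using compact_G_topology[OF assms(1) maps, of "1 - 1 / real (Suc n)"] assms(4)
    by (force simp: not_le)
  then obtain \<phi> \<psi> where G: "\<And>n. (\<phi> n, \<psi> n) \<in> G_group f"
    and large: "\<And>n. 1 - 1 / real (Suc n) < norm (\<phi> n 0)"
    by metis
  have small: "norm (\<phi> n 0) < 1" for n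
    using AutD(2)[of "\<phi> n"] G[of n] by (force simp: G_group_def)
  then have in_cball: "\<phi> n 0 \<in> cball 0 1" for n
    by (simp add: less_imp_le)
  have "seq_compact (cball (0 :: complex ^ 'm) 1)"
    by (intro compact_imp_seq_compact compact_cball)
  then obtain p s where s: "strict_mono (s :: nat \<Rightarrow> nat)" "((\<lambda>n. \<phi> n 0) \<circ> s) \<longlonglongrightarrow> p"
    by (rule seq_compactE[where f="\<lambda>n. \<phi> n 0"]) (use in_cball in auto)
  have lim: "(\<lambda>n. \<phi> (s n) 0) \<longlonglongrightarrow> p"
    using s(2) by (simp add: comp_def)
  have p: "norm p = 1"
  proof -
    have "(\<lambda>n. 1 - 1 / real (Suc n)) \<longlonglongrightarrow> 1 - 0"
      by (intro tendsto_intros LIMSEQ_Suc[OF lim_1_over_n])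
    then have low: "(\<lambda>n. 1 - 1 / real (Suc n)) \<longlonglongrightarrow> 1" by simp
    have "(\<lambda>n. norm (\<phi> n 0)) \<longlonglongrightarrow> 1"
      by (rule tendsto_sandwich[OF _ _ low tendsto_const])
         (intro always_eventually allI less_imp_le large small)+
    from LIMSEQ_subseq_LIMSEQ[OF this s(1)]
    have "(\<lambda>n. norm (\<phi> (s n) 0)) \<longlonglongrightarrow> 1"
      by (simp add: comp_def)
    then show ?thesis
      by (rule LIMSEQ_unique[OF tendsto_norm[OF lim]])
  qed
  then have "p \<in> cball 0 1" by simp
  from bspec[OF F(2)[unfolded C2_smooth_on_def] this]
  obtain U g where Ug: "open U \<and> p \<in> U \<and> C2_on_open g U \<and> (\<forall>y\<in>U \<inter> cball 0 1. g y = F y)"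
    by (elim exE)
  then have nbhd: "open U" "p \<in> U" "C2_on_open g U" and gF: "\<And>y. y \<in> U \<inter> cball 0 1 \<Longrightarrow> g y = F y"
    by simp_all
  obtain g' g'' where "(\<forall>x\<in>U. (g has_derivative blinfun_apply (g' x)) (at x)) \<and>
      (\<forall>x\<in>U. (g' has_derivative blinfun_apply (g'' x)) (at x)) \<and> continuous_on U g''"
    using nbhd(3) unfolding C2_on_open_def by (elim exE)
  then have g: "\<And>x. x \<in> U \<Longrightarrow> (g has_derivative blinfun_apply (g' x)) (at x)"
    "\<And>x. x \<in> U \<Longrightarrow> (g' has_derivative blinfun_apply (g'' x)) (at x)" "continuous_on U g''"
    by simp_all
  interpret boundary_extension f g g' g'' U
  proof
    show "g z = f z" if "z \<in> U" "norm z < 1" for z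
      using gF[of z] F(3)[of z] that by simp
    show "norm (g q) = 1" if q: "q \<in> U" "norm q = 1" for q
    proof -
      have gq: "g q = F q"
        using gF[of q] q by simp
      have "\<forall>\<^sub>F z in at q. z \<in> U"
        using nbhd(1) q(1) by (rule eventually_at_in_open')
      then have "\<forall>\<^sub>F z in at q. norm z < 1 \<longrightarrow> g z = F z"
        by (rule eventually_mono) (simp add: gF)
      moreover have "(g \<longlongrightarrow> F q) (at q)"
        using has_derivative_continuous[OF g(1)[OF q(1)]] gq by (simp add: continuous_at)
      ultimately show ?thesis
        unfolding gq using proper_map_sphere_to_sphere[OF assms(2) F(1,3) _ _ q(2)] by blast
    qed
  qed (fact assms(1) maps nbhd(1) g)+
  obtain D where D: "(f has_derivative D) (at 0)" "complex_linear D"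
    by (rule holomorphic_map_onE[OF assms(1), of 0]) auto
  have "bergman (f 0) (D v) = (norm v)\<^sup>2" for v
    by (rule derivative_isometric_at_0[OF nbhd(2) p G lim D(1)])
  from linear_normal_form[OF assms(1) maps D this]
  obtain L where L: "linear L" "complex_linear L" "\<And>v. norm (L v) = norm v"
    "\<And>z. norm z < 1 \<Longrightarrow> mob (f 0) (f z) = L z" by metis
  have nf: "norm (f z) < 1" if "norm z < 1" for z
    using image_subset_iff[THEN iffD1, OF maps] that by simp
  show ?thesis
  proof (intro conjI allI impI)
    show "CARD('m) \<le> CARD('n)"
      using card_le_if_isometry L(1,3) .
    fix \<iota> :: "'m \<Rightarrow> 'n" assume "inj \<iota>"
    then obtain A :: "complex ^ 'n ^ 'n" where A: "isometric_matrix A" "\<And>z. A *v L z = pad_zero \<iota> z"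
      using unitary_completion L(1-3) by metis
    let ?\<phi>1 = "restrict (\<lambda>z. z) (ball 0 1) :: complex ^ 'm \<Rightarrow> complex ^ 'm"
    let ?\<phi>2 = "restrict (unitary_mob (A, f 0)) (ball 0 1)"
    have "holomorphic_map_on (\<lambda>z. z) (ball 0 1 :: (complex ^ 'm) set)"
      using holomorphic_matrix[of "mat 1"] by simp
    then have "?\<phi>1 \<in> Aut (ball 0 1)"
      by (intro AutI[where k="\<lambda>z. z"]) auto
    moreover have "?\<phi>2 \<in> Aut (ball 0 1)"
      using A(1) nf[of 0] by (intro unitary_mob_in_Aut) (simp add: open_Aut_parameters_def)
    moreover have "\<forall>z\<in>ball 0 1. ?\<phi>2 (f (?\<phi>1 z)) = pad_zero \<iota> z"
      using nf L(4) A(2) by (simp add: unitary_mob_def)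
    ultimately show "\<exists>\<phi>\<^sub>1 \<in> Aut (ball 0 1). \<exists>\<phi>\<^sub>2 \<in> Aut (ball 0 1).
        \<forall>z\<in>ball 0 1. \<phi>\<^sub>2 (f (\<phi>\<^sub>1 z)) = pad_zero \<iota> z"
      by blast
  qed
qed

end
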